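(* Let $\boldsymbol{y}=\boldsymbol{X}\boldsymbol{\beta}^*+\boldsymbol{\epsilon}$ be the sub-Gaussian linear model described in the context, with $k^*$ the number of non-zero entries of $\boldsymbol{\beta}^*$, and $G,s^*,m^*$ the group quantities defined there. Let $\delta\in(0,\tfrac1n)$ and $\alpha\ge 2$. The following results hold with probability at least $1-\delta$. (1) (Lasso) Assume $\|\boldsymbol{X}_j\|_2\le\sqrt n$ for every column $\boldsymbol{X}_j$, $j=1,\dots,p$. Let $\hat{\boldsymbol{\beta}}_1$ be a solution of $$\min_{\boldsymbol{\beta}\in\mathbb{R}^p}\ \frac1n\|\boldsymbol{y}-\boldsymbol{X}\boldsymbol{\beta}\|_2^2+\lambda\|\boldsymbol{\beta}\|_1,\qquad \lambda=24\,\alpha\,\sigma\sqrt{n^{-1}\log(2pe/k^* )\,\log(1/\delta)},$$ and let $S_0\subset\{1,\dots,p\}$ be the subset of indexes of the $k^*$ highest coefficients (in absolute value) of $\boldsymbol{h}_1:=\hat{\boldsymbol{\beta}}_1-\boldsymbol{\beta}^*$. Then $$\boldsymbol{h}_1\in\Lambda\Big(S_0,\ \gamma_1^*:=\frac{\alpha}{\alpha-1},\ \gamma_2^*:=\frac{\sqrt{k^*}}{\alpha-1}\Big).$$ (2) (Group Lasso) Assume that almost surely $\sup_{g=1,\dots,G}\mu_{\max}(\boldsymbol{X}_g^T\boldsymbol{X}_g)\le n$. Let $m_0$ be the total size of the $s^*$ largest groups and assume $m_0\le\gamma m^*$ for some $\gamma\ge1$. Let $\hat{\boldsymbol{\beta}}_{L1-L2}$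 be a solution of $$\min_{\boldsymbol{\beta}\in\mathbb{R}^p}\ \frac1n\|\boldsymbol{y}-\boldsymbol{X}\boldsymbol{\beta}\|_2^2+\lambda_G\sum_{g=1}^G\|\boldsymbol{\beta}_g\|_2,\qquad \lambda_G=24\,\alpha\,\sigma\sqrt{n^{-1}\log(2Ge/s^* )\,\log(2/\delta)}+4\,\alpha\,\sigma\sqrt{n^{-1}\gamma\,(s^* )^{-1}m^*},$$ and let $\mathcal{J}_0\subset\{1,\dots,G\}$ be the subset of indexes of the $s^*$ highest groups of $\boldsymbol{h}_{L1-L2}:=\hat{\boldsymbol{\beta}}_{L1-L2}-\boldsymbol{\beta}^*$ for the L2 norm. Then $$\boldsymbol{h}_{L1-L2}\in\Omega\Big(\mathcal{J}_0,\ \epsilon_1^*:=\frac{\alpha}{\alpha-1},\ \epsilon_2^*:=\frac{\sqrt{s^*}}{\alpha-1}\Big).$$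
   Context: Model: $\boldsymbol{y}=\boldsymbol{X}\boldsymbol{\beta}^*+\boldsymbol{\epsilon}$ with $\boldsymbol{y}\in\mathbb{R}^n$, model matrix $\boldsymbol{X}\in\mathbb{R}^{n\times p}$, ground truth $\boldsymbol{\beta}^*\in\mathbb{R}^p$ with $k^*$ non-zero entries, and $\boldsymbol{\epsilon}=(\epsilon_1,\dots,\epsilon_n)$ whose entries are independent realizations of a sub-Gaussian random variable with variance (proxy) $\sigma^2$, i.e. $\mathbb{E}\,\epsilon_i=0$ and $\mathbb{E}\exp(t\epsilon_i)\le\exp(\sigma^2t^2/2)$ for all $t\in\mathbb{R}$. In the formulas for $\lambda,\lambda_G$, $e=\exp(1)$. Groups: the coefficient indexes $\{1,\dots,p\}$ are split into known disjoint groups $\mathcal{I}_1,\dots,\mathcal{I}_G$, with sizes $n_g=|\mathcal{I}_g|$. For $\boldsymbol{z}\in\mathbb{R}^p$, $\boldsymbol{z}_g$ is the restriction of $\boldsymbol{z}$ to $\mathcal{I}_g$, and $\boldsymbol{z}_S$ its restriction to an index set $S$. $\boldsymbol{X}_g\in\mathbb{R}^{n\times n_g}$ is the restriction of $\boldsymbol{X}$ to the columns in $\mathcal{I}_g$, and $\mu_{\max}$ denotes the highest eigenvalue. $\mathcal{J}^*\subset\{1,\dots,G\}$ is the smallest subset of group indexes such that the support of $\boldsymbol{\beta}^*$ is included in the union of these groups; $s^*=|\mathcal{J}^*|$; $m^*$ is the sum of the sizes of these $s^*$ groups. Cones: for $S\subset\{1,\dots,p\}$ and $\gamma_1,\gamma_2>0$,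 $$\Lambda(S,\gamma_1,\gamma_2)=\{\boldsymbol{z}\in\mathbb{R}^p:\ \|\boldsymbol{z}_{S^c}\|_1\le\gamma_1\|\boldsymbol{z}_S\|_1+\gamma_2\|\boldsymbol{z}_S\|_2\}.$$ For $\mathcal{J}\subset\{1,\dots,G\}$, $\mathcal{T}(\mathcal{J})=\cup_{g\in\mathcal{J}}\mathcal{I}_g$, and $\epsilon_1,\epsilon_2>0$ (scalars unrelated to the noise), $$\Omega(\mathcal{J},\epsilon_1,\epsilon_2)=\Big\{\boldsymbol{z}\in\mathbb{R}^p:\ \sum_{g\notin\mathcal{J}}\|\boldsymbol{z}_g\|_2\le\epsilon_1\sum_{g\in\mathcal{J}}\|\boldsymbol{z}_g\|_2+\epsilon_2\|\boldsymbol{z}_{\mathcal{T}(\mathcal{J})}\|_2\Big\}.$$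
   Formalization: Part (1) is proved for δ ≤ 1/2, automatic when n ≥ 2 (for n = 1 and δ near 1 it fails); also assumed: σ > 0 (for σ = 0 the claim fails), β* ≠ 0 and nonempty groups (otherwise the formulas are undefined); X is deterministic. *)

theory Defs
  imports "HOL-Probability.Probability"
begin

text \<open>
  Conventions: the sample indices, the coefficient indices and the group indices are the elements
  of finite types, so \<open>n = CARD('n)\<close>, \<open>p = CARD('p)\<close>, \<open>G = CARD('g)\<close>. The restriction of a vector
  \<open>z\<close> to an index set \<open>S\<close> only occurs inside norms: its L1 norm is \<open>\<Sum>j\<in>S. \<bar>z $ j\<bar>\<close> and its L2 norm
  is \<open>L2_set (($) z) S\<close>.
\<close>

definition sub_gaussian :: "'w measure \<Rightarrow> ('w \<Rightarrow> real) \<Rightarrow> real \<Rightarrow> bool" where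
  "sub_gaussian M f \<sigma> \<longleftrightarrow>
     integrable M f \<and> (LINT \<omega>|M. f \<omega>) = 0 \<and>
     (\<forall>t. integrable M (\<lambda>\<omega>. exp (t * f \<omega>)) \<and>
          (LINT \<omega>|M. exp (t * f \<omega>)) \<le> exp (\<sigma>\<^sup>2 * t\<^sup>2 / 2))"

text \<open>The set of outcomes satisfying \<open>P\<close> need not be measurable (\<open>P\<close> may quantify over all
  minimizers), so the bound is required for a measurable event contained in it.\<close>

definition with_prob_at_least :: "'w measure \<Rightarrow> real \<Rightarrow> ('w \<Rightarrow> bool) \<Rightarrow> bool" where
  "with_prob_at_least M q P \<longleftrightarrow> (\<exists>E\<in>sets M. q \<le> measure M E \<and> (\<forall>\<omega>\<in>E. P \<omega>))"

definition supp :: "real ^ 'p \<Rightarrow> 'p set" where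
  "supp z = {j. z $ j \<noteq> 0}"

text \<open>\<open>S\<close> consists of the indices of the \<open>k\<close> highest values of \<open>f\<close>; ties are broken arbitrarily, so
  \<open>S\<close> need not be unique.\<close>

definition highest :: "nat \<Rightarrow> ('i::finite \<Rightarrow> real) \<Rightarrow> 'i set \<Rightarrow> bool" where
  "highest k f S \<longleftrightarrow> card S = k \<and> (\<forall>i\<in>S. \<forall>j\<in>-S. f j \<le> f i)"

definition group_partition :: "('g \<Rightarrow> 'p set) \<Rightarrow> bool" where
  "group_partition I \<longleftrightarrow> disjoint_family I \<and> (\<Union>g. I g) = UNIV \<and> (\<forall>g. I g \<noteq> {})"

text \<open>Least with respect to inclusion; well defined because the groups are disjoint and cover all
  indices, and then also the unique such set of least cardinality.\<close>

definition active_groups :: "('g \<Rightarrow> 'p set) \<Rightarrow> real ^ 'p \<Rightarrow> 'g set" where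
  "active_groups I z = (LEAST J. supp z \<subseteq> (\<Union>g\<in>J. I g))"

definition total_size :: "('g \<Rightarrow> 'p set) \<Rightarrow> 'g set \<Rightarrow> nat" where
  "total_size I J = (\<Sum>g\<in>J. card (I g))"

text \<open>Eigenvalues of the square matrix \<open>A\<close> whose rows and columns are indexed by the set \<open>S\<close>.\<close>

definition eigenvalue_on :: "'i set \<Rightarrow> ('i \<Rightarrow> 'i \<Rightarrow> real) \<Rightarrow> real \<Rightarrow> bool" where
  "eigenvalue_on S A \<mu> \<longleftrightarrow>
     (\<exists>v. (\<exists>j\<in>S. v j \<noteq> 0) \<and> (\<forall>j\<in>S. (\<Sum>l\<in>S. A j l * v l) = \<mu> * v j))"

definition mu_max :: "'i set \<Rightarrow> ('i \<Rightarrow> 'i \<Rightarrow> real) \<Rightarrow> real" where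
  "mu_max S A = Max {\<mu>. eigenvalue_on S A \<mu>}"

text \<open>On indices \<open>j, l \<in> I g\<close> these are the entries of \<open>X\<^sub>g\<^sup>T X\<^sub>g\<close>, where \<open>X\<^sub>g\<close> has the columns of \<open>X\<close>
  indexed by \<open>I g\<close>.\<close>

definition gram :: "real ^ 'p ^ 'n \<Rightarrow> 'p \<Rightarrow> 'p \<Rightarrow> real" where
  "gram X j l = column j X \<bullet> column l X"

definition l1_cone :: "'p set \<Rightarrow> real \<Rightarrow> real \<Rightarrow> (real ^ 'p) set" where
  "l1_cone S \<gamma>1 \<gamma>2 =
     {z. (\<Sum>j\<in>-S. \<bar>z $ j\<bar>) \<le> \<gamma>1 * (\<Sum>j\<in>S. \<bar>z $ j\<bar>) + \<gamma>2 * L2_set (($) z) S}"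

definition group_cone ::
    "('g \<Rightarrow> 'p set) \<Rightarrow> 'g set \<Rightarrow> real \<Rightarrow> real \<Rightarrow> (real ^ 'p) set" where
  "group_cone I J \<epsilon>1 \<epsilon>2 =
     {z. (\<Sum>g\<in>-J. L2_set (($) z) (I g))
          \<le> \<epsilon>1 * (\<Sum>g\<in>J. L2_set (($) z) (I g)) + \<epsilon>2 * L2_set (($) z) (\<Union>g\<in>J. I g)}"

definition lasso_objective ::
    "real ^ 'p ^ 'n \<Rightarrow> real ^ 'n \<Rightarrow> real \<Rightarrow> real ^ 'p \<Rightarrow> real" where
  "lasso_objective X y reg \<beta> =
     1 / real CARD('n) * (norm (y - X *v \<beta>))\<^sup>2 + reg * (\<Sum>j\<in>UNIV. \<bar>\<beta> $ j\<bar>)"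

definition group_lasso_objective ::
    "('g::finite \<Rightarrow> 'p set) \<Rightarrow> real ^ 'p ^ 'n \<Rightarrow> real ^ 'n \<Rightarrow> real \<Rightarrow> real ^ 'p \<Rightarrow> real" where
  "group_lasso_objective I X y reg \<beta> =
     1 / real CARD('n) * (norm (y - X *v \<beta>))\<^sup>2 + reg * (\<Sum>g\<in>UNIV. L2_set (($) \<beta>) (I g))"

definition minimizer :: "('a \<Rightarrow> real) \<Rightarrow> 'a \<Rightarrow> bool" where
  "minimizer f x \<longleftrightarrow> is_arg_min f (\<lambda>_. True) x"

definition lasso_lambda :: "real \<Rightarrow> real \<Rightarrow> real \<Rightarrow> nat \<Rightarrow> nat \<Rightarrow> nat \<Rightarrow> real" where
  "lasso_lambda \<alpha> \<sigma> \<delta> n p k =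
     24 * \<alpha> * \<sigma> * sqrt (1 / real n * ln (2 * real p * exp 1 / real k) * ln (1 / \<delta>))"

definition group_lasso_lambda ::
    "real \<Rightarrow> real \<Rightarrow> real \<Rightarrow> real \<Rightarrow> nat \<Rightarrow> nat \<Rightarrow> nat \<Rightarrow> nat \<Rightarrow> real" where
  "group_lasso_lambda \<alpha> \<sigma> \<delta> \<gamma> n G s m =
     24 * \<alpha> * \<sigma> * sqrt (1 / real n * ln (2 * real G * exp 1 / real s) * ln (2 / \<delta>))
     + 4 * \<alpha> * \<sigma> * sqrt (1 / real n * \<gamma> * (1 / real s) * real m)"

end

theory Submission
  imports Defs
begin

text \<open>
  The Lasso is the group Lasso with singleton groups, so both parts follow the same route. Let
  \<open>u\<^sub>g = \<parallel>X\<^sub>g\<^sup>T \<epsilon>\<parallel> / \<surd>n\<close> and \<open>v\<^sub>g = \<parallel>h\<^sub>g\<parallel>\<close>. Optimality of the estimator reduces the cone condition to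
  bounding \<open>\<Sum>u\<^sub>g v\<^sub>g\<close> by a multiple of \<open>\<surd>s \<parallel>v\<^sub>J\<parallel>\<^sub>2 + \<parallel>v\<^sub>-\<^sub>J\<parallel>\<^sub>1\<close>, where \<open>J\<close> carries the \<open>s\<close> highest \<open>v\<^sub>g\<close>.
  Split \<open>u\<^sub>g \<le> \<kappa>\<^sub>g + \<tau> + w\<^sub>g\<close> with \<open>\<kappa>\<^sub>g = \<sigma> \<surd>n\<^sub>g\<close> (\<open>\<kappa> = 0\<close> for the Lasso), a level
  \<open>\<tau> = 4 \<sigma> \<surd>(L D)\<close>, \<open>L = ln (2Ge/s)\<close>, and \<open>w\<^sub>g\<close> the positive part of the remainder. Markov's
  inequality for the sum of \<open>exp (t (u\<^sub>g - \<kappa>\<^sub>g - \<tau>))\<close> at \<open>t = \<tau> / \<sigma>\<^sup>2\<close> gives \<open>\<Sum>w\<^sub>g\<^sup>2 \<le> s \<tau>\<^sup>2\<close> with probability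
  at least \<open>1 - exp (-D) / 2\<close>, because the factor \<open>G/s\<close> is \<open>exp L / (2e)\<close> and \<open>8 L D \<ge> L + D\<close>.

  The bound \<open>E exp (t (u\<^sub>g - \<sigma> \<surd>n\<^sub>g)) \<le> exp (\<sigma>\<^sup>2 t\<^sup>2 / 2)\<close> comes from writing \<open>exp (x u\<^sub>g\<^sup>2 / (2 \<sigma>\<^sup>2))\<close> as an
  average of \<open>exp (\<surd>x / \<sigma> \<langle>z, X\<^sub>g\<^sup>T \<epsilon> / \<surd>n\<rangle>)\<close> over a standard Gaussian \<open>z\<close>, exchanging the two expectations,
  and optimizing over \<open>x\<close>.
\<close>

section \<open>Exponential moments and exceedances\<close>

lemma sub_gaussian_nn_mgf:
  assumes "sub_gaussian M f \<sigma>"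
  shows "(\<integral>\<^sup>+\<omega>. ennreal (exp (t * f \<omega>)) \<partial>M) \<le> ennreal (exp (\<sigma>\<^sup>2 * t\<^sup>2 / 2))"
  using assms unfolding sub_gaussian_def
  by (subst nn_integral_eq_integral) (auto intro: ennreal_leI)

text \<open>Independence factorizes the exponential moment, and the exponents
  \<open>\<sigma>\<^sup>2 * (c $ i)\<^sup>2 / 2\<close> add up to the squared norm of
  \<open>c\<close>. Working with non-negative integrals avoids integrability conditions.\<close>

lemma sub_gaussian_inner_mgf:
  fixes \<epsilon> :: "'w \<Rightarrow> real ^ 'n"
  assumes "prob_space M"
    and indep: "prob_space.indep_vars M (\<lambda>_. borel) (\<lambda>i \<omega>. \<epsilon> \<omega> $ i) UNIV"
    and sg: "\<And>i. sub_gaussian M (\<lambda>\<omega>. \<epsilon> \<omega> $ i) \<sigma>"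
  shows "(\<integral>\<^sup>+\<omega>. ennreal (exp (c \<bullet> \<epsilon> \<omega>)) \<partial>M) \<le> ennreal (exp (\<sigma>\<^sup>2 * (norm c)\<^sup>2 / 2))"
proof -
  interpret prob_space M by fact
  have ind: "indep_vars (\<lambda>_. borel) (\<lambda>i \<omega>. ennreal (exp (c $ i * \<epsilon> \<omega> $ i))) UNIV"
    by (rule indep_vars_compose2[OF indep]) measurable
  have "(\<integral>\<^sup>+\<omega>. ennreal (exp (c \<bullet> \<epsilon> \<omega>)) \<partial>M)
      = (\<integral>\<^sup>+\<omega>. (\<Prod>i\<in>UNIV. ennreal (exp (c $ i * \<epsilon> \<omega> $ i))) \<partial>M)"
    by (simp add: inner_vec_def exp_sum prod_ennreal)
  also have "\<dots> = (\<Prod>i\<in>UNIV. \<integral>\<^sup>+\<omega>. ennreal (exp (c $ i * \<epsilon> \<omega> $ i)) \<partial>M)"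
    by (rule indep_vars_nn_integral[OF _ ind]) auto
  also have "\<dots> \<le> (\<Prod>i\<in>UNIV. ennreal (exp (\<sigma>\<^sup>2 * (c $ i)\<^sup>2 / 2)))"
    by (intro prod_mono_ennreal sub_gaussian_nn_mgf[OF sg])
  also have "\<dots> = ennreal (exp (\<sigma>\<^sup>2 * (norm c)\<^sup>2 / 2))"
    by (simp add: prod_ennreal exp_sum[symmetric] norm_vec_def L2_set_def sum_nonneg
        sum_distrib_left sum_divide_distrib)
  finally show ?thesis .
qed

section \<open>Gaussian averaging and exponential moments of Euclidean norms\<close>

abbreviation std_gaussian :: "real measure" where
  "std_gaussian \<equiv> density lborel (\<lambda>x. ennreal (std_normal_density x))"

lemma nn_integral_normal_density:
  assumes "0 < s"
  shows "(\<integral>\<^sup>+x. ennreal (normal_density m s x) \<partial>lborel) = 1"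
  using prob_space.emeasure_space_1[OF prob_space_normal_density[OF assms, of m]]
  by (simp add: emeasure_density)

text \<open>Completing the square: tilting the standard density by \<open>exp (t * z)\<close> shifts
  its mean to \<open>t\<close>.\<close>

lemma std_gaussian_mgf:
  "(\<integral>\<^sup>+z. ennreal (exp (t * z)) \<partial>std_gaussian) = ennreal (exp (t\<^sup>2 / 2))"
proof -
  have "std_normal_density z * exp (t * z) = exp (t\<^sup>2 / 2) * normal_density t 1 z" for z
    by (simp add: normal_density_def mult_exp_exp field_simps power2_diff)
  then have "(\<integral>\<^sup>+z. ennreal (exp (t * z)) \<partial>std_gaussian)
      = (\<integral>\<^sup>+z. ennreal (exp (t\<^sup>2 / 2)) * ennreal (normal_density t 1 z) \<partial>lborel)"
    by (simp add: nn_integral_density ennreal_mult'[symmetric])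
  also have "\<dots> = ennreal (exp (t\<^sup>2 / 2))"
    by (simp add: nn_integral_cmult nn_integral_normal_density)
  finally show ?thesis .
qed

text \<open>Tilting by the square leaves a centered Gaussian, now of variance
  \<open>1 / (1 - x)\<close>, which is positive because \<open>x < 1\<close>; \<open>s\<close> is
  its standard deviation.\<close>

lemma std_gaussian_square_mgf:
  assumes "x < 1"
  shows "(\<integral>\<^sup>+z. ennreal (exp (x * z\<^sup>2 / 2)) \<partial>std_gaussian) = ennreal (1 / sqrt (1 - x))"
proof -
  define s where "s = 1 / sqrt (1 - x)"
  have s: "s > 0" "1 / s\<^sup>2 = 1 - x" "s\<^sup>2 > 0"
    using assms by (auto simp: s_def power_divide)
  have "- z\<^sup>2 / 2 + x * z\<^sup>2 / 2 = - z\<^sup>2 / (2 * s\<^sup>2)" for z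
    using s(2) s(3) assms by (simp add: s_def power_divide field_simps)
  then have "std_normal_density z * exp (x * z\<^sup>2 / 2) = s * normal_density 0 s z" for z
    using s(1) by (simp add: normal_density_def mult_exp_exp real_sqrt_mult)
  then have "(\<integral>\<^sup>+z. ennreal (exp (x * z\<^sup>2 / 2)) \<partial>std_gaussian)
      = (\<integral>\<^sup>+z. ennreal s * ennreal (normal_density 0 s z) \<partial>lborel)"
    using s(1) by (simp add: nn_integral_density ennreal_mult'[symmetric])
  also have "\<dots> = ennreal s"
    using s(1) by (simp add: nn_integral_cmult nn_integral_normal_density)
  finally show ?thesis by (simp add: s_def)
qed

text \<open>The entries of \<open>W\<close> may depend on each other, since only joint moments in
  all directions \<open>z\<close> enter. The bound is the exact value for independent centered
  Gaussian entries of variance \<open>\<sigma>\<^sup>2\<close>.\<close>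

lemma sub_gaussian_vector_square_mgf:
  fixes W :: "'j \<Rightarrow> 'w \<Rightarrow> real"
  assumes "prob_space M" and S: "finite S"
    and meas: "\<And>j. j \<in> S \<Longrightarrow> W j \<in> borel_measurable M"
    and "\<sigma> > 0" "0 \<le> x" "x < 1"
    and sg: "\<And>z. (\<integral>\<^sup>+\<omega>. ennreal (exp (\<Sum>j\<in>S. z j * W j \<omega>)) \<partial>M)
                \<le> ennreal (exp (\<sigma>\<^sup>2 * (\<Sum>j\<in>S. (z j)\<^sup>2) / 2))"
  shows "(\<integral>\<^sup>+\<omega>. ennreal (exp (x * (\<Sum>j\<in>S. (W j \<omega>)\<^sup>2) / (2 * \<sigma>\<^sup>2))) \<partial>M)
           \<le> ennreal ((1 / sqrt (1 - x)) ^ card S)"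
proof -
  interpret prob_space M by fact
  interpret N: prob_space std_gaussian
    by (rule prob_space_normal_density) simp
  interpret N: product_sigma_finite "\<lambda>_::'j. std_gaussian" ..
  define P where "P = Pi\<^sub>M S (\<lambda>_::'j. std_gaussian)"
  interpret P: sigma_finite_measure P
    unfolding P_def by (rule N.sigma_finite[OF S])
  interpret MP: pair_sigma_finite P M ..
  \<comment> \<open>With this scale,
    \<open>x * (W j \<omega>)\<^sup>2 / (2 * \<sigma>\<^sup>2)\<close> is the exponent of the
    standard Gaussian moment taken at \<open>a * W j \<omega>\<close>.\<close>
  define a where "a = sqrt x / \<sigma>"
  have a2: "a\<^sup>2 = x / \<sigma>\<^sup>2"
    using assms by (simp add: a_def power_divide)
  have [measurable]: "(\<lambda>p. fst p j) \<in> borel_measurable (P \<Otimes>\<^sub>M M)" if "j \<in> S" for j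
  proof -
    have "(\<lambda>z. z j) \<in> measurable P std_gaussian"
      unfolding P_def using that by (rule measurable_component_singleton)
    then have "(\<lambda>z. z j) \<in> borel_measurable P" by simp
    then show ?thesis by measurable
  qed
  have [measurable]: "(\<lambda>p. W j (snd p)) \<in> borel_measurable (P \<Otimes>\<^sub>M M)" if "j \<in> S" for j
    using meas[OF that] by measurable
  have decouple: "ennreal (exp (x * (\<Sum>j\<in>S. (W j \<omega>)\<^sup>2) / (2 * \<sigma>\<^sup>2)))
      = (\<integral>\<^sup>+z. ennreal (exp (\<Sum>j\<in>S. (a * z j) * W j \<omega>)) \<partial>P)" for \<omega>
  proof -
    have "x * (\<Sum>j\<in>S. (W j \<omega>)\<^sup>2) / (2 * \<sigma>\<^sup>2) = (\<Sum>j\<in>S. (a * W j \<omega>)\<^sup>2 / 2)"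
      by (simp add: power_mult_distrib a2 sum_distrib_left sum_divide_distrib mult.commute)
    then have "ennreal (exp (x * (\<Sum>j\<in>S. (W j \<omega>)\<^sup>2) / (2 * \<sigma>\<^sup>2)))
        = (\<Prod>j\<in>S. ennreal (exp ((a * W j \<omega>)\<^sup>2 / 2)))"
      using S by (simp add: exp_sum prod_ennreal)
    also have "\<dots> = (\<Prod>j\<in>S. \<integral>\<^sup>+z. ennreal (exp ((a * W j \<omega>) * z)) \<partial>std_gaussian)"
      by (simp only: std_gaussian_mgf)
    also have "\<dots> = (\<integral>\<^sup>+z. (\<Prod>j\<in>S. ennreal (exp ((a * W j \<omega>) * z j))) \<partial>P)"
      unfolding P_def
      by (rule N.product_nn_integral_prod[symmetric, OF S, where f="\<lambda>j y. ennreal (exp ((a * W j \<omega>) * y))"]) simp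
    also have "\<dots> = (\<integral>\<^sup>+z. ennreal (exp (\<Sum>j\<in>S. (a * z j) * W j \<omega>)) \<partial>P)"
      using S by (simp add: exp_sum prod_ennreal mult_ac)
    finally show ?thesis .
  qed
  have "(\<integral>\<^sup>+\<omega>. ennreal (exp (x * (\<Sum>j\<in>S. (W j \<omega>)\<^sup>2) / (2 * \<sigma>\<^sup>2))) \<partial>M)
      = (\<integral>\<^sup>+\<omega>. (\<integral>\<^sup>+z. ennreal (exp (\<Sum>j\<in>S. (a * z j) * W j \<omega>)) \<partial>P) \<partial>M)"
    by (simp only: decouple)
  also have "\<dots> = (\<integral>\<^sup>+z. (\<integral>\<^sup>+\<omega>. ennreal (exp (\<Sum>j\<in>S. (a * z j) * W j \<omega>)) \<partial>M) \<partial>P)"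
    by (rule MP.Fubini') (simp add: split_beta)
  \<comment> \<open>After the exchange \<open>z\<close> is fixed, so the moment hypothesis applies
    in the direction \<open>a * z\<close>; a product of moments of Gaussian squares remains.\<close>
  also have "\<dots> \<le> (\<integral>\<^sup>+z. ennreal (exp (\<sigma>\<^sup>2 * (\<Sum>j\<in>S. (a * z j)\<^sup>2) / 2)) \<partial>P)"
    by (intro nn_integral_mono sg)
  also have "\<dots> = (\<integral>\<^sup>+z. (\<Prod>j\<in>S. ennreal (exp (x * (z j)\<^sup>2 / 2))) \<partial>P)"
    using S \<open>\<sigma> > 0\<close>
    by (simp add: exp_sum[symmetric] prod_ennreal power_mult_distrib a2 sum_distrib_left
        sum_divide_distrib)
  also have "\<dots> = (\<Prod>j\<in>S. \<integral>\<^sup>+z. ennreal (exp (x * z\<^sup>2 / 2)) \<partial>std_gaussian)"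
    unfolding P_def
    by (rule N.product_nn_integral_prod[OF S, where f="\<lambda>_ y. ennreal (exp (x * y\<^sup>2 / 2))"]) simp
  also have "\<dots> = ennreal ((1 / sqrt (1 - x)) ^ card S)"
    using \<open>x < 1\<close> by (simp only: std_gaussian_square_mgf prod_constant) (simp add: ennreal_power)
  finally show ?thesis .
qed

text \<open>Young's inequality replaces the norm by its square at weight \<open>x\<close>, whose
  moment is at most \<open>(1 - x)\<close> to the power \<open>- card S / 2\<close>. Parametrizing
  \<open>x = q / (1 + q)\<close> turns this into a power of \<open>1 + q \<le> exp q\<close>, and
  makes \<open>1 / x = 1 + 1 / q\<close> explicit.\<close>

lemma sub_gaussian_norm_mgf:
  fixes W :: "'j \<Rightarrow> 'w \<Rightarrow> real"
  assumes "prob_space M" and S: "finite S" "S \<noteq> {}"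
    and meas: "\<And>j. j \<in> S \<Longrightarrow> W j \<in> borel_measurable M"
    and "\<sigma> > 0" "t > 0"
    and sg: "\<And>z. (\<integral>\<^sup>+\<omega>. ennreal (exp (\<Sum>j\<in>S. z j * W j \<omega>)) \<partial>M)
                \<le> ennreal (exp (\<sigma>\<^sup>2 * (\<Sum>j\<in>S. (z j)\<^sup>2) / 2))"
  shows "(\<integral>\<^sup>+\<omega>. ennreal (exp (t * (L2_set (\<lambda>j. W j \<omega>) S - \<sigma> * sqrt (card S)))) \<partial>M)
           \<le> ennreal (exp (\<sigma>\<^sup>2 * t\<^sup>2 / 2))"
proof -
  \<comment> \<open>This \<open>q\<close> balances the two costs: \<open>r\<^sup>2 * q / 2\<close>
    from the moment of the square and \<open>s\<^sup>2 / (2 * q)\<close> from Young's inequality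
    both become \<open>s * r / 2\<close>.\<close>
  define r s q x where "r = sqrt (card S)" and "s = t * \<sigma>" and "q = s / r" and "x = q / (1 + q)"
  have r: "r > 0" "r\<^sup>2 = card S"
    using S by (auto simp: r_def card_gt_0_iff)
  have s: "s > 0" using assms by (simp add: s_def)
  have q: "q > 0" using r s by (simp add: q_def)
  have x: "0 < x" "x < 1" "1 / (1 - x) = 1 + q" "1 / x = 1 + 1 / q"
    using q by (auto simp: x_def field_simps)
  have young: "t * N \<le> s\<^sup>2 / (2 * x) + x * N\<^sup>2 / (2 * \<sigma>\<^sup>2)" for N
  proof -
    have "0 \<le> (s / sqrt x - sqrt x * N / \<sigma>)\<^sup>2" by simp
    also have "\<dots> = s\<^sup>2 / x + x * N\<^sup>2 / \<sigma>\<^sup>2 - 2 * (t * N)"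
      using x \<open>\<sigma> > 0\<close> by (simp add: power2_diff power_divide power_mult_distrib s_def)
    finally have "2 * (t * N) \<le> s\<^sup>2 / x + x * N\<^sup>2 / \<sigma>\<^sup>2" by simp
    then have "t * N \<le> (s\<^sup>2 / x + x * N\<^sup>2 / \<sigma>\<^sup>2) / 2" by simp
    then show ?thesis by (simp add: add_divide_distrib mult.commute)
  qed
  have pow: "(1 / sqrt (1 - x)) ^ card S \<le> exp (s * r / 2)"
  proof -
    have "(1 / sqrt (1 - x))\<^sup>2 \<le> (exp (q / 2))\<^sup>2"
    proof -
      have "(1 / sqrt (1 - x))\<^sup>2 = 1 + q"
        using x by (simp add: power_divide)
      also have "\<dots> \<le> exp q" by (rule exp_ge_add_one_self)
      also have "\<dots> = (exp (q / 2))\<^sup>2" by (simp add: exp_double[symmetric])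
      finally show ?thesis .
    qed
    then have "1 / sqrt (1 - x) \<le> exp (q / 2)"
      by (rule power2_le_imp_le) simp
    then have "(1 / sqrt (1 - x)) ^ card S \<le> exp (q / 2) ^ card S"
      using x by (intro power_mono) auto
    also have "\<dots> = exp (r\<^sup>2 * (q / 2))"
      by (simp add: r(2) flip: exp_of_nat_mult)
    also have "r\<^sup>2 * (q / 2) = s * r / 2"
      using r(1) by (simp add: q_def power2_eq_square)
    finally show ?thesis .
  qed
  define C where "C = exp (s\<^sup>2 / (2 * x) - s * r)"
  have "(\<integral>\<^sup>+\<omega>. ennreal (exp (t * (L2_set (\<lambda>j. W j \<omega>) S - \<sigma> * sqrt (card S)))) \<partial>M)
     \<le> (\<integral>\<^sup>+\<omega>. ennreal C * ennreal (exp (x * (\<Sum>j\<in>S. (W j \<omega>)\<^sup>2) / (2 * \<sigma>\<^sup>2))) \<partial>M)"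
  proof (intro nn_integral_mono)
    fix \<omega>
    have "t * (L2_set (\<lambda>j. W j \<omega>) S - \<sigma> * sqrt (card S))
        \<le> s\<^sup>2 / (2 * x) - s * r + x * (\<Sum>j\<in>S. (W j \<omega>)\<^sup>2) / (2 * \<sigma>\<^sup>2)"
      using young[of "L2_set (\<lambda>j. W j \<omega>) S"]
      by (simp add: L2_set_def sum_nonneg s_def r_def algebra_simps)
    then show "ennreal (exp (t * (L2_set (\<lambda>j. W j \<omega>) S - \<sigma> * sqrt (card S))))
        \<le> ennreal C * ennreal (exp (x * (\<Sum>j\<in>S. (W j \<omega>)\<^sup>2) / (2 * \<sigma>\<^sup>2)))"
      by (simp add: C_def ennreal_mult'[symmetric] mult_exp_exp)
  qed
  also have "\<dots> = ennreal C * (\<integral>\<^sup>+\<omega>. ennreal (exp (x * (\<Sum>j\<in>S. (W j \<omega>)\<^sup>2) / (2 * \<sigma>\<^sup>2))) \<partial>M)"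
    using meas by (intro nn_integral_cmult) simp
  also have "\<dots> \<le> ennreal C * ennreal ((1 / sqrt (1 - x)) ^ card S)"
    using assms x by (intro mult_left_mono sub_gaussian_vector_square_mgf) auto
  also have "\<dots> \<le> ennreal C * ennreal (exp (s * r / 2))"
    by (intro mult_left_mono ennreal_leI pow) auto
  \<comment> \<open>The two costs \<open>s * r / 2\<close> cancel against the subtracted level
    \<open>t * \<sigma> * sqrt (card S) = s * r\<close>, leaving
    \<open>s\<^sup>2 / 2\<close>.\<close>
  also have "\<dots> = ennreal (exp (\<sigma>\<^sup>2 * t\<^sup>2 / 2))"
  proof -
    have "s\<^sup>2 / (2 * x) = s\<^sup>2 / 2 * (1 + 1 / q)"
      unfolding x(4)[symmetric] by simp
    also have "\<dots> = s\<^sup>2 / 2 + s * r / 2"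
      using r(1) s by (simp add: q_def field_simps power2_eq_square)
    finally show ?thesis
      by (simp add: C_def ennreal_mult'[symmetric] mult_exp_exp s_def power_mult_distrib mult.commute)
  qed
  finally show ?thesis .
qed

text \<open>The expectations of the exponentials are summed, so no independence among the
  \<open>R i\<close> enters. Comparing the sum with a multiple of \<open>k\<close>, instead of
  controlling every index, gains the factor \<open>1 / k\<close>, which turns
  \<open>ln CARD('i)\<close> into the logarithm of a ratio. The factor 2 in the moment bound makes
  room for absolute values.\<close>

lemma sum_sq_exceedance_bound:
  fixes R :: "'i::finite \<Rightarrow> 'w \<Rightarrow> real" and k :: nat
  assumes "prob_space M" and meas[measurable]: "\<And>i. R i \<in> borel_measurable M" and "\<sigma> > 0"
    and mgf: "\<And>i t. t > 0 \<Longrightarrow>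
      (\<integral>\<^sup>+\<omega>. ennreal (exp (t * R i \<omega>)) \<partial>M) \<le> ennreal (2 * exp (\<sigma>\<^sup>2 * t\<^sup>2 / 2))"
    and k: "0 < k" "k \<le> CARD('i)" and D: "1 / 2 \<le> D"
    and \<tau>: "\<tau> = 4 * \<sigma> * sqrt (ln (2 * real CARD('i) * exp 1 / real k) * D)"
  shows "with_prob_at_least M (1 - exp (- D) / 2)
           (\<lambda>\<omega>. (\<Sum>i\<in>UNIV. (max 0 (R i \<omega> - \<tau>))\<^sup>2) \<le> real k * \<tau>\<^sup>2)"
proof -
  interpret prob_space M by fact
  define N where "N = real CARD('i)"
  define L where "L = ln (2 * N * exp 1 / real k)"
  have N: "N \<ge> real k" "N > 0" using k by (auto simp: N_def)
  have expL: "exp L = 2 * N * exp 1 / real k"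
    using N k unfolding L_def by (subst exp_ln) auto
  have L: "L \<ge> 1"
  proof -
    have "exp 1 \<le> 2 * N * exp 1 / real k"
      using N k by (simp add: field_simps)
    then show ?thesis using expL by (metis exp_le_cancel_iff)
  qed
  have LD: "L * D \<ge> 1 / 2" "L * D \<ge> D" "2 * (L * D) \<ge> L"
    using L D mult_mono[of 1 L "1/2" D] mult_right_mono[of 1 L D] mult_left_mono[of "1/2" D L] by auto
  have \<tau>2: "\<tau>\<^sup>2 = 16 * \<sigma>\<^sup>2 * (L * D)" and "\<tau> > 0"
    using LD \<open>\<sigma> > 0\<close> by (auto simp: \<tau> L_def N_def power_mult_distrib)
  \<comment> \<open>This value minimizes the Chernoff exponent
    \<open>\<sigma>\<^sup>2 * u\<^sup>2 / 2 - u * \<tau>\<close>.\<close>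
  define u where "u = \<tau> / \<sigma>\<^sup>2"
  have u: "u > 0" "\<sigma>\<^sup>2 * u\<^sup>2 / 2 - u * \<tau> = - (8 * (L * D))" "u\<^sup>2 * \<tau>\<^sup>2 = 256 * (L * D)\<^sup>2"
    using \<open>\<tau> > 0\<close> \<open>\<sigma> > 0\<close> \<tau>2
    by (auto simp: u_def field_simps power2_eq_square)
  define Z where "Z \<omega> = (\<Sum>i\<in>UNIV. exp (u * (R i \<omega> - \<tau>)))" for \<omega>
  \<comment> \<open>Chosen so that \<open>2 / u\<^sup>2 * c = real k * \<tau>\<^sup>2\<close>, the
    bound wanted on the complement of the event \<open>c \<le> Z \<omega>\<close>.\<close>
  define c where "c = 128 * real k * (L * D)\<^sup>2"
  have c: "c > 0" using k L D by (auto simp: c_def intro!: mult_pos_pos zero_less_power)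
  have [measurable]: "Z \<in> borel_measurable M" unfolding Z_def by measurable
  have EZ: "(\<integral>\<^sup>+\<omega>. ennreal (Z \<omega>) \<partial>M) \<le> ennreal (2 * N * exp (- (8 * (L * D))))"
  proof -
    have "(\<integral>\<^sup>+\<omega>. ennreal (Z \<omega>) \<partial>M)
        = (\<Sum>i\<in>UNIV. \<integral>\<^sup>+\<omega>. ennreal (exp (- (u * \<tau>))) * ennreal (exp (u * R i \<omega>)) \<partial>M)"
      by (simp add: Z_def sum_ennreal[symmetric] nn_integral_sum ennreal_mult'[symmetric]
          mult_exp_exp right_diff_distrib del: sum_ennreal)
    also have "\<dots> = (\<Sum>i\<in>UNIV. ennreal (exp (- (u * \<tau>))) * (\<integral>\<^sup>+\<omega>. ennreal (exp (u * R i \<omega>)) \<partial>M))"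
      by (intro sum.cong refl nn_integral_cmult) measurable
    also have "\<dots> \<le> (\<Sum>i\<in>(UNIV::'i set). ennreal (exp (- (u * \<tau>))) * ennreal (2 * exp (\<sigma>\<^sup>2 * u\<^sup>2 / 2)))"
      using u(1) by (intro sum_mono mult_left_mono mgf) auto
    also have "\<dots> = (\<Sum>i\<in>(UNIV::'i set). ennreal (2 * exp (- (8 * (L * D)))))"
    proof -
      have "- (u * \<tau>) + \<sigma>\<^sup>2 * u\<^sup>2 / 2 = - (8 * (L * D))" using u(2) by linarith
      then have "exp (- (u * \<tau>)) * (2 * exp (\<sigma>\<^sup>2 * u\<^sup>2 / 2)) = 2 * exp (- (8 * (L * D)))"
        by (metis exp_add mult.left_commute)
      then show ?thesis by (simp only: ennreal_mult'[symmetric] exp_ge_zero)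
    qed
    also have "\<dots> = ennreal (2 * N * exp (- (8 * (L * D))))"
      by (simp add: N_def ennreal_mult' mult_ac flip: ennreal_of_nat_eq_real_of_nat)
    finally show ?thesis .
  qed
  \<comment> \<open>Since \<open>2 * N = k * exp (L - 1)\<close>, the claim reduces to
    \<open>exp (L + D - 8 * (L * D)) \<le> 64 * (L * D)\<^sup>2 * exp 1\<close>. The left side is at
    most 1 because \<open>L + D \<le> 3 * (L * D)\<close>, and the right side is at least
    16.\<close>
  have small: "1 / c * (2 * N * exp (- (8 * (L * D)))) \<le> exp (- D) / 2"
  proof -
    have "64 * (1 / 2)\<^sup>2 * 1 \<le> 64 * (L * D)\<^sup>2 * exp (1::real)"
      using LD by (intro mult_mono power_mono) auto
    moreover have "64 * (1 / 2)\<^sup>2 * 1 = (16::real)" by (simp add: power_divide)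
    ultimately have "1 \<le> 64 * (L * D)\<^sup>2 * exp (1::real)" by linarith
    moreover have "exp (L + D - 8 * (L * D)) \<le> 1"
      using LD by simp
    ultimately have "exp (L + D - 8 * (L * D)) \<le> 64 * (L * D)\<^sup>2 * exp 1" by linarith
    then have "exp L * exp D * exp (- (8 * (L * D))) \<le> 64 * (L * D)\<^sup>2 * exp 1"
      by (simp add: exp_add[symmetric] algebra_simps)
    then have "2 * N * exp D * exp (- (8 * (L * D))) \<le> c / 2"
      using k by (simp add: expL c_def field_simps)
    then show ?thesis using c by (simp add: exp_minus field_simps)
  qed
  have "emeasure M {\<omega> \<in> space M. 1 \<le> ennreal (1 / c) * ennreal (Z \<omega>)}
      \<le> ennreal (1 / c) * (\<integral>\<^sup>+\<omega>. ennreal (Z \<omega>) * indicator (space M) \<omega> \<partial>M)"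
    by (rule nn_integral_Markov_inequality) auto
  also have "(\<integral>\<^sup>+\<omega>. ennreal (Z \<omega>) * indicator (space M) \<omega> \<partial>M) = (\<integral>\<^sup>+\<omega>. ennreal (Z \<omega>) \<partial>M)"
    by (intro nn_integral_cong) simp
  also have "ennreal (1 / c) * \<dots> \<le> ennreal (1 / c) * ennreal (2 * N * exp (- (8 * (L * D))))"
    by (intro mult_left_mono EZ) simp
  also have "\<dots> \<le> ennreal (exp (- D) / 2)"
    using small c by (simp add: ennreal_mult'[symmetric] ennreal_leI)
  also have "{\<omega> \<in> space M. 1 \<le> ennreal (1 / c) * ennreal (Z \<omega>)} = {\<omega> \<in> space M. c \<le> Z \<omega>}"
  proof -
    have "1 \<le> ennreal (1 / c) * ennreal (Z \<omega>) \<longleftrightarrow> 1 \<le> ennreal (1 / c * Z \<omega>)" for \<omega>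
      using c by (subst ennreal_mult') auto
    then show ?thesis using c by (simp add: field_simps)
  qed
  finally have "prob {\<omega> \<in> space M. c \<le> Z \<omega>} \<le> exp (- D) / 2"
    by (simp add: emeasure_eq_measure)
  moreover define E where "E = space M - {\<omega> \<in> space M. c \<le> Z \<omega>}"
  ultimately have "1 - exp (- D) / 2 \<le> prob E"
    unfolding E_def by (subst prob_compl) auto
  moreover have "E \<in> sets M" unfolding E_def by measurable
  moreover have "(\<Sum>i\<in>UNIV. (max 0 (R i \<omega> - \<tau>))\<^sup>2) \<le> real k * \<tau>\<^sup>2" if "\<omega> \<in> E" for \<omega>
  proof -
    \<comment> \<open>For positive \<open>y\<close> this is the quadratic term of the exponential
      series; the positive part vanishes otherwise.\<close>
    have sq: "(max 0 y)\<^sup>2 \<le> 2 / u\<^sup>2 * exp (u * y)" for y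
    proof (cases "y \<ge> 0")
      case True
      have "(u * y)\<^sup>2 / 2 \<le> exp (u * y)"
        using exp_lower_Taylor_quadratic[of "u * y"] True u(1) by (smt (verit) mult_nonneg_nonneg)
      then show ?thesis using True u(1) by (simp add: field_simps power_mult_distrib)
    next
      case False
      then show ?thesis by simp
    qed
    have "(\<Sum>i\<in>UNIV. (max 0 (R i \<omega> - \<tau>))\<^sup>2) \<le> 2 / u\<^sup>2 * Z \<omega>"
      unfolding Z_def sum_distrib_left by (intro sum_mono sq)
    also have "\<dots> \<le> 2 / u\<^sup>2 * c"
      using that u(1) by (intro mult_left_mono) (auto simp: E_def)
    also have "\<dots> = real k * \<tau>\<^sup>2"
      using u by (simp add: c_def field_simps)
    finally show ?thesis .
  qed
  ultimately show ?thesis unfolding with_prob_at_least_def by blast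
qed

section \<open>The largest eigenvalue of a Gram matrix\<close>

lemma matrix_vector_mult_supported:
  fixes X :: "real ^ 'p ^ 'n"
  assumes "\<And>j. j \<notin> S \<Longrightarrow> z $ j = 0"
  shows "X *v z = (\<Sum>j\<in>S. z $ j *\<^sub>R column j X)"
proof -
  have "X *v z = (\<Sum>j\<in>UNIV. z $ j *\<^sub>R column j X)"
    by (simp add: matrix_mult_sum scalar_mult_eq_scaleR)
  also have "\<dots> = (\<Sum>j\<in>S. z $ j *\<^sub>R column j X)"
    using assms by (intro sum.mono_neutral_right) auto
  finally show ?thesis .
qed

text \<open>Extending an eigenvector by zero outside \<open>S\<close> replaces the submatrix by
  \<open>X\<close> itself and makes the inner product of the full space available.\<close>

lemma eigenvalue_on_gram_iff:
  fixes X :: "real ^ 'p ^ 'n"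
  shows "eigenvalue_on S (gram X) \<mu> \<longleftrightarrow>
    (\<exists>z. z \<noteq> 0 \<and> (\<forall>j. j \<notin> S \<longrightarrow> z $ j = 0) \<and> (\<forall>j\<in>S. column j X \<bullet> (X *v z) = \<mu> * z $ j))"
    (is "_ \<longleftrightarrow> ?R")
proof
  assume "eigenvalue_on S (gram X) \<mu>"
  then obtain v where v: "\<exists>j\<in>S. v j \<noteq> 0" "\<And>j. j \<in> S \<Longrightarrow> (\<Sum>l\<in>S. gram X j l * v l) = \<mu> * v j"
    unfolding eigenvalue_on_def by blast
  define z :: "real ^ 'p" where "z = (\<chi> j. if j \<in> S then v j else 0)"
  have "X *v z = (\<Sum>l\<in>S. z $ l *\<^sub>R column l X)"
    by (rule matrix_vector_mult_supported) (simp add: z_def)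
  then have "column j X \<bullet> (X *v z) = \<mu> * z $ j" if "j \<in> S" for j
    using v(2)[OF that] that
    by (simp add: inner_sum_right z_def gram_def mult.commute)
  moreover have "z \<noteq> 0" using v(1) by (auto simp: z_def vec_eq_iff)
  moreover have "z $ j = 0" if "j \<notin> S" for j using that by (simp add: z_def)
  ultimately show ?R by blast
next
  assume ?R
  then obtain z where z: "z \<noteq> 0" "\<And>j. j \<notin> S \<Longrightarrow> z $ j = 0"
    "\<And>j. j \<in> S \<Longrightarrow> column j X \<bullet> (X *v z) = \<mu> * z $ j" by blast
  have "X *v z = (\<Sum>l\<in>S. z $ l *\<^sub>R column l X)"
    by (rule matrix_vector_mult_supported) (rule z(2))
  then have "(\<Sum>l\<in>S. gram X j l * z $ l) = \<mu> * z $ j" if "j \<in> S" for j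
    using z(3)[OF that] by (simp add: inner_sum_right gram_def mult.commute)
  moreover have "\<exists>j\<in>S. z $ j \<noteq> 0"
    using z(1,2) by (metis vec_eq_iff zero_index)
  ultimately show "eigenvalue_on S (gram X) \<mu>"
    unfolding eigenvalue_on_def by blast
qed

text \<open>The eigenvalue equation is paired with \<open>w\<close>; the support condition discards
  the coordinates outside \<open>S\<close>, where that equation says nothing.\<close>

lemma gram_eigenvector_inner:
  fixes X :: "real ^ 'p ^ 'n"
  assumes z: "\<forall>j\<in>S. column j X \<bullet> (X *v z) = \<mu> * z $ j"
    and w: "\<And>j. j \<notin> S \<Longrightarrow> w $ j = 0"
  shows "(X *v w) \<bullet> (X *v z) = \<mu> * (w \<bullet> z)"
proof -
  have "(X *v w) \<bullet> (X *v z) = (\<Sum>j\<in>S. w $ j * (column j X \<bullet> (X *v z)))"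
    by (simp add: matrix_vector_mult_supported[OF w] inner_sum_left)
  also have "\<dots> = (\<Sum>j\<in>S. \<mu> * (w $ j * z $ j))"
    using z by (intro sum.cong) auto
  also have "\<dots> = (\<Sum>j\<in>UNIV. \<mu> * (w $ j * z $ j))"
    using w by (intro sum.mono_neutral_left) auto
  finally show ?thesis by (simp add: inner_vec_def sum_distrib_left)
qed

text \<open>Eigenvectors of a symmetric matrix for distinct eigenvalues are orthogonal.\<close>

lemma finite_eigenvalues_gram:
  fixes X :: "real ^ 'p ^ 'n"
  shows "finite {\<mu>. eigenvalue_on S (gram X) \<mu>}"
proof -
  let ?E = "{\<mu>. eigenvalue_on S (gram X) \<mu>}"
  have "\<forall>\<mu>\<in>?E. \<exists>z. z \<noteq> 0 \<and> (\<forall>j. j \<notin> S \<longrightarrow> z $ j = 0)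
      \<and> (\<forall>j\<in>S. column j X \<bullet> (X *v z) = \<mu> * z $ j)"
    using eigenvalue_on_gram_iff[of S X] by simp
  from bchoice[OF this] obtain f where f: "\<And>\<mu>. \<mu> \<in> ?E \<Longrightarrow> f \<mu> \<noteq> 0"
    "\<And>\<mu> j. \<mu> \<in> ?E \<Longrightarrow> j \<notin> S \<Longrightarrow> f \<mu> $ j = 0"
    "\<And>\<mu>. \<mu> \<in> ?E \<Longrightarrow> \<forall>j\<in>S. column j X \<bullet> (X *v f \<mu>) = \<mu> * f \<mu> $ j"
    by blast
  have orth: "f \<mu> \<bullet> f \<nu> = 0" if "\<mu> \<in> ?E" "\<nu> \<in> ?E" "\<mu> \<noteq> \<nu>" for \<mu> \<nu>
  proof -
    have "\<nu> * (f \<mu> \<bullet> f \<nu>) = \<mu> * (f \<nu> \<bullet> f \<mu>)"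
      using gram_eigenvector_inner[OF f(3)[OF that(2)] f(2)[OF that(1)]]
        gram_eigenvector_inner[OF f(3)[OF that(1)] f(2)[OF that(2)]]
      by (simp add: inner_commute)
    then show ?thesis using that(3) by (simp add: inner_commute)
  qed
  \<comment> \<open>A vector shared by two distinct eigenvalues would be orthogonal to itself, hence
    zero. Injectivity carries finiteness back from the eigenvectors to the eigenvalues.\<close>
  have "inj_on f ?E"
    using orth f(1) by (metis inj_onI inner_eq_zero_iff)
  moreover have "independent (f ` ?E)"
  proof (rule pairwise_orthogonal_independent)
    show "pairwise orthogonal (f ` ?E)"
      unfolding pairwise_def orthogonal_def using orth by blast
    show "0 \<notin> f ` ?E" using f(1) by force
  qed
  ultimately show ?thesis
    using independent_imp_finite finite_imageD by blast
qed

text \<open>A maximizer of the quadratic form on the unit sphere is an eigenvector.\<close>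

lemma norm_matrix_vector_mult_le_mu_max:
  fixes X :: "real ^ 'p ^ 'n"
  assumes supp: "\<And>j. j \<notin> S \<Longrightarrow> w $ j = 0"
  shows "(norm (X *v w))\<^sup>2 \<le> mu_max S (gram X) * (norm w)\<^sup>2"
proof (cases "w = 0")
  case False
  define V where "V = {z :: real ^ 'p. \<forall>j. j \<notin> S \<longrightarrow> z $ j = 0}"
  have V: "subspace V" unfolding V_def subspace_def by auto
  have "w \<in> V" using supp by (simp add: V_def)
  define K where "K = sphere 0 1 \<inter> V"
  have "compact K"
    unfolding K_def by (intro compact_Int_closed compact_sphere closed_subspace V)
  have inK: "(1 / norm z) *\<^sub>R z \<in> K" if "z \<in> V" "z \<noteq> 0" for z
    using that V by (auto simp: K_def subspace_scale)
  have "K \<noteq> {}" using inK[OF \<open>w \<in> V\<close> False] by blast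
  have "continuous_on K (\<lambda>z. (norm (X *v z))\<^sup>2)"
    by (intro continuous_intros matrix_vector_mult_linear_continuous_on)
  then obtain z where z: "z \<in> K" "\<And>y. y \<in> K \<Longrightarrow> (norm (X *v y))\<^sup>2 \<le> (norm (X *v z))\<^sup>2"
    using continuous_attains_sup[OF \<open>compact K\<close> \<open>K \<noteq> {}\<close>] by blast
  define \<mu> where "\<mu> = (norm (X *v z))\<^sup>2"
  have zV: "z \<in> V" "norm z = 1" using z(1) by (auto simp: K_def)
  have le: "(norm (X *v y))\<^sup>2 \<le> \<mu> * (norm y)\<^sup>2" if "y \<in> V" for y
  proof (cases "y = 0")
    case False
    have "(norm (X *v ((1 / norm y) *\<^sub>R y)))\<^sup>2 \<le> \<mu>"
      unfolding \<mu>_def by (rule z(2)[OF inK[OF that False]])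
    then show ?thesis using False
      by (simp add: matrix_vector_mult_scaleR power_mult_distrib field_simps)
  qed simp
  have crit: "(X *v y) \<bullet> (X *v z) = \<mu> * (y \<bullet> z)" if "y \<in> V" for y
  proof -
    define b where "b = \<mu> * (y \<bullet> z) - (X *v y) \<bullet> (X *v z)"
    define q where "q = \<mu> * (norm y)\<^sup>2 - (norm (X *v y))\<^sup>2"
    \<comment> \<open>This is \<open>le\<close> along the line \<open>z + t *\<^sub>R y\<close>.
      Equality holds at \<open>t = 0\<close>, so the linear coefficient \<open>b\<close> has to
      vanish.\<close>
    have nonneg: "0 \<le> 2 * t * b + t\<^sup>2 * q" for t
    proof -
      have "z + t *\<^sub>R y \<in> V"
        using V that zV by (simp add: subspace_add subspace_scale)
      from le[OF this] have "(norm (X *v z + t *\<^sub>R (X *v y)))\<^sup>2 \<le> \<mu> * (norm (z + t *\<^sub>R y))\<^sup>2"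
        by (simp add: matrix_vector_right_distrib matrix_vector_mult_scaleR)
      moreover have "(norm (X *v z + t *\<^sub>R (X *v y)))\<^sup>2
          = \<mu> + 2 * t * ((X *v y) \<bullet> (X *v z)) + t\<^sup>2 * (norm (X *v y))\<^sup>2"
        by (simp only: \<mu>_def power2_norm_eq_inner)
          (simp add: inner_add_left inner_add_right inner_commute power2_eq_square algebra_simps)
      moreover have "(norm (z + t *\<^sub>R y))\<^sup>2 = 1 + 2 * t * (y \<bullet> z) + t\<^sup>2 * (norm y)\<^sup>2"
        using zV(2) by (simp only: power2_norm_eq_inner norm_eq_1)
          (simp add: inner_add_left inner_add_right inner_commute power2_eq_square algebra_simps)
      ultimately show ?thesis
        by (simp add: b_def q_def algebra_simps)
    qed
    have "b = 0"
    proof (rule ccontr)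
      assume "b \<noteq> 0"
      \<comment> \<open>A positive bound above \<open>q\<close>; then \<open>t = - b / d\<close>
        gives the negative value \<open>- (b\<^sup>2 / d)\<close>.\<close>
      define d where "d = \<bar>q\<bar> + 1"
      define t where "t = - b / d"
      have "d > 0" by (simp add: d_def)
      have "2 * t * b + t\<^sup>2 * q \<le> 2 * t * b + t\<^sup>2 * d"
        by (intro add_left_mono mult_left_mono) (auto simp: d_def)
      also have "\<dots> = - (b\<^sup>2 / d)"
        using \<open>d > 0\<close> by (simp add: t_def power2_eq_square field_simps)
      also have "\<dots> < 0" using \<open>b \<noteq> 0\<close> \<open>d > 0\<close> by simp
      finally show False using nonneg[of t] by simp
    qed
    then show ?thesis by (simp add: b_def)
  qed
  have "column j X \<bullet> (X *v z) = \<mu> * z $ j" if "j \<in> S" for j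
  proof -
    have "axis j 1 \<in> V" using that by (auto simp: V_def axis_def)
    from crit[OF this] show ?thesis by (simp add: matrix_vector_mult_basis inner_axis')
  qed
  moreover have "z \<noteq> 0" using zV(2) by auto
  ultimately have "eigenvalue_on S (gram X) \<mu>"
    unfolding eigenvalue_on_gram_iff using zV(1) by (auto simp: V_def)
  \<comment> \<open>\<open>mu_max\<close> is a \<open>Max\<close>, so it dominates the eigenvalue
    \<open>\<mu>\<close> only once the set of eigenvalues is known to be finite.\<close>
  then have "\<mu> \<le> mu_max S (gram X)"
    unfolding mu_max_def by (intro Max_ge finite_eigenvalues_gram) simp
  then show ?thesis
    using le[OF \<open>w \<in> V\<close>] by (meson mult_right_mono order_trans zero_le_power2)
qed simp

section \<open>Sums over highest entries\<close>

text \<open>Exchange argument: \<open>A - S\<close> and \<open>S - A\<close> have equally many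
  elements, and any bijection from the first to the second does not decrease
  \<open>f\<close>.\<close>

lemma highest_sum_ge:
  assumes "highest k f S" "card A = k"
  shows "sum f A \<le> sum f S"
proof -
  have fin: "finite A" "finite S" by auto
  have "card (A - S) = card (S - A)"
    using assms fin by (simp add: highest_def card_Diff_subset_Int Int_commute)
  then obtain h where h: "bij_betw h (A - S) (S - A)"
    using finite_same_card_bij[of "A - S" "S - A"] by auto
  have "sum f (A - S) \<le> (\<Sum>i\<in>A - S. f (h i))"
    using assms(1) h by (intro sum_mono) (auto simp: highest_def bij_betw_def)
  also have "\<dots> = sum f (S - A)" by (rule sum.reindex_bij_betw[OF h])
  finally have "sum f (A - S) \<le> sum f (S - A)" .
  then show ?thesis
    using sum.Int_Diff[OF fin(1), of f S] sum.Int_Diff[OF fin(2), of f A] by (simp add: Int_commute)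
qed

text \<open>A value outside is at most each of the \<open>k\<close> values inside, hence at most
  their quadratic mean.\<close>

lemma highest_outside_le:
  assumes "highest k f S" "k > 0" "\<And>i. 0 \<le> f i" "j \<notin> S"
  shows "sqrt (real k) * f j \<le> L2_set f S"
proof -
  have "real k * (f j)\<^sup>2 = (\<Sum>i\<in>S. (f j)\<^sup>2)"
    using assms by (simp add: highest_def)
  also have "\<dots> \<le> (\<Sum>i\<in>S. (f i)\<^sup>2)"
    using assms by (intro sum_mono power_mono) (auto simp: highest_def)
  finally have "sqrt (real k * (f j)\<^sup>2) \<le> L2_set f S"
    unfolding L2_set_def by simp
  then show ?thesis using assms by (simp add: real_sqrt_mult)
qed

lemma sum_le_sqrt_card_L2_set:
  "(\<And>i. i \<in> S \<Longrightarrow> 0 \<le> f i) \<Longrightarrow> sum f S \<le> sqrt (card S) * L2_set f S"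
  using L2_set_mult_ineq[of "\<lambda>_. 1" f S] by (simp add: L2_set_constant)

lemma sum_UNIV_split: "sum f UNIV = sum f S + sum f (- S)" for S :: "'i::finite set"
  by (metis Compl_eq_Diff_UNIV finite sum.subset_diff subset_UNIV add.commute)

text \<open>By Cauchy-Schwarz it suffices to bound \<open>sqrt (real k) * L2_set v UNIV\<close>. The
  entries outside \<open>J\<close> are at most \<open>a / sqrt (real k)\<close>, so their squares
  contribute at most a product of \<open>a\<close> and the L1 tail \<open>b\<close>, and the
  resulting quadratic form lies below a perfect square.\<close>

lemma highest_sum_mult_le:
  fixes v w :: "'i::finite \<Rightarrow> real"
  assumes v: "\<And>i. 0 \<le> v i" and J: "highest k v J" "k > 0"
    and w: "\<And>i. 0 \<le> w i" "(\<Sum>i\<in>UNIV. (w i)\<^sup>2) \<le> real k * \<tau>\<^sup>2" and "0 \<le> \<tau>"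
  shows "(\<Sum>i\<in>UNIV. w i * v i) \<le> \<tau> * (3 / 2 * (sqrt (real k) * L2_set v J) + (\<Sum>i\<in>-J. v i) / 2)"
proof -
  define a b where "a = L2_set v J" and "b = (\<Sum>i\<in>-J. v i)"
  have ab: "0 \<le> a" "0 \<le> b" using v by (auto simp: a_def b_def sum_nonneg)
  have "real k * (\<Sum>i\<in>-J. (v i)\<^sup>2) \<le> sqrt (real k) * a * b"
  proof -
    have "real k * (\<Sum>i\<in>-J. (v i)\<^sup>2) = sqrt (real k) * (\<Sum>i\<in>-J. (sqrt (real k) * v i) * v i)"
      by (simp add: sum_distrib_left power2_eq_square mult_ac)
    also have "\<dots> \<le> sqrt (real k) * (\<Sum>i\<in>-J. a * v i)"
      using highest_outside_le[OF J v] v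
      by (intro mult_left_mono sum_mono mult_right_mono) (auto simp: a_def)
    finally show ?thesis by (simp add: b_def sum_distrib_left mult_ac)
  qed
  then have "(sqrt (real k) * L2_set v UNIV)\<^sup>2 \<le> (sqrt (real k) * a)\<^sup>2 + sqrt (real k) * a * b"
    by (simp add: power_mult_distrib L2_set_def sum_nonneg a_def sum_UNIV_split[of _ J] distrib_left)
  also have "\<dots> \<le> (3 / 2 * (sqrt (real k) * a) + b / 2)\<^sup>2"
    using ab by (simp add: power2_sum power_mult_distrib power_divide)
      (simp add: field_simps)
  finally have *: "sqrt (real k) * L2_set v UNIV \<le> 3 / 2 * (sqrt (real k) * a) + b / 2"
    by (rule power2_le_imp_le) (use ab in auto)
  have "(\<Sum>i\<in>UNIV. w i * v i) \<le> L2_set w UNIV * L2_set v UNIV"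
    using L2_set_mult_ineq[of w v UNIV] v w by simp
  also have "\<dots> \<le> (sqrt (real k) * \<tau>) * L2_set v UNIV"
    using real_sqrt_le_mono[OF w(2)] \<open>0 \<le> \<tau>\<close>
    by (intro mult_right_mono) (auto simp: L2_set_def real_sqrt_mult sum_nonneg)
  also have "\<dots> = \<tau> * (sqrt (real k) * L2_set v UNIV)" by simp
  also have "\<dots> \<le> \<tau> * (3 / 2 * (sqrt (real k) * a) + b / 2)"
    using * \<open>0 \<le> \<tau>\<close> by (rule mult_left_mono)
  finally show ?thesis by (simp add: a_def b_def)
qed

text \<open>For group sizes \<open>c\<close>, the index set is split into \<open>J\<close>,
  \<open>L - J\<close> and the rest. On the first two pieces Cauchy-Schwarz applies, as the sizes
  there sum to at most \<open>m\<close>; on the rest each size is at most the average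
  \<open>m / real k\<close>.\<close>

lemma highest_sum_sqrt_mult_le:
  fixes c v :: "'i::finite \<Rightarrow> real"
  assumes v: "\<And>i. 0 \<le> v i" and J: "highest k v J" "k > 0"
    and c: "\<And>i. 0 \<le> c i" and L: "highest k c L" "sum c L \<le> m"
  shows "(\<Sum>i\<in>UNIV. sqrt (c i) * v i)
      \<le> sqrt (m / real k) * (2 * (sqrt (real k) * L2_set v J) + (\<Sum>i\<in>-J. v i))"
proof -
  define a b where "a = L2_set v J" and "b = (\<Sum>i\<in>-J. v i)"
  have a: "0 \<le> a" by (simp add: a_def)
  have m: "0 \<le> m" using L(2) c sum_nonneg[of L c] by force
  have sqrtm: "sqrt (m / real k) * sqrt (real k) = sqrt m"
    using J(2) by (simp add: real_sqrt_divide)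
  have cs: "(\<Sum>i\<in>A. sqrt (c i) * v i) \<le> sqrt m * r"
    if "sum c A \<le> m" "L2_set v A \<le> r" for A r
  proof -
    have "(\<Sum>i\<in>A. sqrt (c i) * v i) \<le> L2_set (\<lambda>i. sqrt (c i)) A * L2_set v A"
      using L2_set_mult_ineq[of "\<lambda>i. sqrt (c i)" v A] v c by simp
    also have "\<dots> \<le> sqrt m * r"
      using that c m by (intro mult_mono) (auto simp: L2_set_def sum_nonneg)
    finally show ?thesis .
  qed
  have "sum c J \<le> m"
    using highest_sum_ge[OF L(1), of J] J L(2) by (simp add: highest_def)
  then have inJ: "(\<Sum>i\<in>J. sqrt (c i) * v i) \<le> sqrt m * a"
    by (rule cs) (simp add: a_def)
  \<comment> \<open>There are at most \<open>k\<close> indices here, and each lies outside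
    \<open>J\<close>, so its \<open>v\<close> is at most \<open>a / sqrt (real k)\<close>.\<close>
  have "L2_set v (L - J) \<le> a"
  proof -
    have "real k * (\<Sum>i\<in>L - J. (v i)\<^sup>2) = (\<Sum>i\<in>L - J. (sqrt (real k) * v i)\<^sup>2)"
      by (simp add: sum_distrib_left power_mult_distrib)
    also have "\<dots> \<le> (\<Sum>i\<in>L - J. a\<^sup>2)"
      using highest_outside_le[OF J v] v by (intro sum_mono power_mono) (auto simp: a_def)
    also have "\<dots> \<le> real k * a\<^sup>2"
      using L(1) card_mono[of L "L - J"] by (auto simp: highest_def intro!: mult_right_mono)
    finally have "(\<Sum>i\<in>L - J. (v i)\<^sup>2) \<le> a\<^sup>2" using J(2) by simp
    then show ?thesis using a by (simp add: L2_set_def real_le_lsqrt sum_nonneg)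
  qed
  moreover have "sum c (L - J) \<le> m"
    using L(2) c sum_mono2[of L "L - J" c] by force
  ultimately have inL: "(\<Sum>i\<in>L - J. sqrt (c i) * v i) \<le> sqrt m * a"
    by (intro cs)
  have out: "(\<Sum>i\<in>-J - L. sqrt (c i) * v i) \<le> sqrt (m / real k) * b"
  proof -
    have "c i \<le> m / real k" if "i \<notin> L" for i
    proof -
      have "real k * c i = (\<Sum>j\<in>L. c i)" using L(1) by (simp add: highest_def)
      also have "\<dots> \<le> sum c L" using L(1) that by (intro sum_mono) (auto simp: highest_def)
      finally show ?thesis using L(2) J(2) by (simp add: field_simps)
    qed
    then have "(\<Sum>i\<in>-J - L. sqrt (c i) * v i) \<le> (\<Sum>i\<in>-J - L. sqrt (m / real k) * v i)"
      using v by (intro sum_mono mult_right_mono) auto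
    also have "\<dots> \<le> (\<Sum>i\<in>-J. sqrt (m / real k) * v i)"
      using v m by (intro sum_mono2) auto
    finally show ?thesis by (simp add: b_def sum_distrib_left)
  qed
  have "(\<Sum>i\<in>UNIV. sqrt (c i) * v i) = (\<Sum>i\<in>J. sqrt (c i) * v i)
      + ((\<Sum>i\<in>L - J. sqrt (c i) * v i) + (\<Sum>i\<in>-J - L. sqrt (c i) * v i))"
  proof -
    have "- J = (L - J) \<union> (- J - L)" by auto
    then have "(\<Sum>i\<in>-J. sqrt (c i) * v i)
        = (\<Sum>i\<in>L - J. sqrt (c i) * v i) + (\<Sum>i\<in>-J - L. sqrt (c i) * v i)"
      by (metis (no_types, lifting) Diff_disjoint Int_Diff Int_commute finite sum.union_disjoint Diff_Int_distrib2 inf_bot_left)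
    then show ?thesis by (simp add: sum_UNIV_split[of _ J])
  qed
  also have "\<dots> \<le> 2 * (sqrt m * a) + sqrt (m / real k) * b"
    using inJ inL out by linarith
  also have "\<dots> = sqrt (m / real k) * (2 * (sqrt (real k) * a) + b)"
    using sqrtm by (simp add: distrib_left flip: mult.assoc)
  finally show ?thesis by (simp add: a_def b_def)
qed

section \<open>The deterministic cone condition\<close>

text \<open>By disjointness, any cover of the support contains every group that meets it; as the
  groups exhaust all indices, these suffice.\<close>

lemma active_groups_eq:
  assumes "group_partition I"
  shows "active_groups I z = {g. I g \<inter> supp z \<noteq> {}}"
  unfolding active_groups_def
proof (rule Least_equality)
  show "supp z \<subseteq> (\<Union>g\<in>{g. I g \<inter> supp z \<noteq> {}}. I g)"
    using assms by (fastforce simp: group_partition_def)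
  fix J assume J: "supp z \<subseteq> (\<Union>g\<in>J. I g)"
  show "{g. I g \<inter> supp z \<noteq> {}} \<subseteq> J"
  proof
    fix g assume "g \<in> {g. I g \<inter> supp z \<noteq> {}}"
    then obtain j where "j \<in> I g" "j \<in> supp z" by blast
    with J obtain g' where "g' \<in> J" "j \<in> I g'" by blast
    with \<open>j \<in> I g\<close> assms have "g = g'"
      by (auto simp: group_partition_def disjoint_family_on_def)
    with \<open>g' \<in> J\<close> show "g \<in> J" by simp
  qed
qed

text \<open>Secures the divisions by the number of active groups in the regularization and in the
  averaging arguments.\<close>

lemma card_active_groups_pos:
  fixes I :: "'g::finite \<Rightarrow> 'p::finite set" and z :: "real ^ 'p"
  assumes "group_partition I" "z \<noteq> 0"
  shows "0 < card (active_groups I z)"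
proof -
  obtain j where "z $ j \<noteq> 0" using \<open>z \<noteq> 0\<close> by (auto simp: vec_eq_iff)
  moreover obtain g where "j \<in> I g" using assms(1) by (auto simp: group_partition_def)
  ultimately have "g \<in> active_groups I z"
    by (auto simp: active_groups_eq[OF assms(1)] supp_def)
  then show ?thesis by (auto simp: card_gt_0_iff)
qed

lemma L2_set_Union_groups:
  fixes I :: "'g::finite \<Rightarrow> 'p::finite set"
  assumes "group_partition I"
  shows "L2_set f (\<Union>g\<in>J. I g) = L2_set (\<lambda>g. L2_set f (I g)) J"
proof -
  have "(\<Sum>j\<in>(\<Union>g\<in>J. I g). (f j)\<^sup>2) = (\<Sum>g\<in>J. \<Sum>j\<in>I g. (f j)\<^sup>2)"
    using assms by (intro sum.UNION_disjoint) (auto simp: group_partition_def disjoint_family_on_def)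
  then show ?thesis by (simp add: L2_set_def sum_nonneg)
qed

text \<open>Cauchy-Schwarz inside each group, so that the noise enters only through the norms of its
  groupwise correlations with the columns.\<close>

lemma inner_matrix_vector_mult_le_groups:
  fixes I :: "'g::finite \<Rightarrow> 'p::finite set" and X :: "real ^ 'p ^ 'n"
  assumes "group_partition I"
  shows "e \<bullet> (X *v h) \<le> (\<Sum>g\<in>UNIV. L2_set (\<lambda>j. column j X \<bullet> e) (I g) * L2_set (($) h) (I g))"
proof -
  have "e \<bullet> (X *v h) = (\<Sum>j\<in>(\<Union>g. I g). (column j X \<bullet> e) * h $ j)"
    using assms matrix_vector_mult_supported[of UNIV h X]
    by (simp add: group_partition_def inner_sum_right inner_commute mult.commute)
  also have "\<dots> = (\<Sum>g\<in>UNIV. \<Sum>j\<in>I g. (column j X \<bullet> e) * h $ j)"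
    using assms by (intro sum.UNION_disjoint) (auto simp: group_partition_def disjoint_family_on_def)
  also have "\<dots> \<le> (\<Sum>g\<in>UNIV. L2_set (\<lambda>j. column j X \<bullet> e) (I g) * L2_set (($) h) (I g))"
  proof (intro sum_mono)
    fix g
    have "(\<Sum>j\<in>I g. (column j X \<bullet> e) * h $ j) \<le> (\<Sum>j\<in>I g. \<bar>column j X \<bullet> e\<bar> * \<bar>h $ j\<bar>)"
      by (intro sum_mono) (metis abs_ge_self abs_mult)
    also have "\<dots> \<le> L2_set (\<lambda>j. column j X \<bullet> e) (I g) * L2_set (($) h) (I g)"
      by (rule L2_set_mult_ineq)
    finally show "(\<Sum>j\<in>I g. (column j X \<bullet> e) * h $ j) \<le> \<dots>" .
  qed
  finally show ?thesis .
qed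

text \<open>The objective at \<open>\<beta>'\<close> is compared with its value at
  \<open>\<beta>\<close>: the noise term is at most \<open>r / \<alpha>\<close> times
  \<open>a + b\<close>, and the change of penalty yields \<open>sum v J - b\<close>. Solving the
  resulting inequality for the tail \<open>b\<close> gives the factors
  \<open>1 / (\<alpha> - 1)\<close>.\<close>

lemma group_lasso_cone:
  fixes I :: "'g::finite \<Rightarrow> 'p::finite set" and X :: "real ^ 'p ^ 'n" and \<beta> \<beta>' h :: "real ^ 'p"
  assumes part: "group_partition I"
    and min: "minimizer (group_lasso_objective I X (X *v \<beta> + e) r) \<beta>'"
    and r: "0 < r" and \<alpha>: "1 < \<alpha>"
    and h: "h = \<beta>' - \<beta>"
    and s: "s = card (active_groups I \<beta>)"
    and J: "highest s (\<lambda>g. L2_set (($) h) (I g)) J"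
    and noise: "2 / real CARD('n) * (e \<bullet> (X *v h))
      \<le> r / \<alpha> * (sqrt (real s) * L2_set (\<lambda>g. L2_set (($) h) (I g)) J + (\<Sum>g\<in>-J. L2_set (($) h) (I g)))"
  shows "h \<in> group_cone I J (\<alpha> / (\<alpha> - 1)) (sqrt (real s) / (\<alpha> - 1))"
proof -
  define n where "n = real CARD('n)"
  define A where "A = active_groups I \<beta>"
  define v where "v g = L2_set (($) h) (I g)" for g
  define a where "a = sqrt (real s) * L2_set v J"
  define b where "b = (\<Sum>g\<in>-J. v g)"
  have n: "n > 0" by (simp add: n_def)
  have "group_lasso_objective I X (X *v \<beta> + e) r \<beta>' \<le> group_lasso_objective I X (X *v \<beta> + e) r \<beta>"
    using min by (simp add: minimizer_def is_arg_min_linorder)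
  moreover have "X *v \<beta> + e - X *v \<beta>' = e - X *v h"
    by (simp add: h matrix_vector_mult_diff_distrib)
  ultimately have "1 / n * (norm (e - X *v h))\<^sup>2 + r * (\<Sum>g\<in>UNIV. L2_set (($) \<beta>') (I g))
      \<le> 1 / n * (norm e)\<^sup>2 + r * (\<Sum>g\<in>UNIV. L2_set (($) \<beta>) (I g))"
    by (simp add: group_lasso_objective_def n_def)
  \<comment> \<open>Expanding the square, the prediction error
    \<open>(norm (X *v h))\<^sup>2\<close> is dropped.\<close>
  moreover have "1 / n * (norm (e - X *v h))\<^sup>2 \<ge> 1 / n * (norm e)\<^sup>2 - 2 / n * (e \<bullet> (X *v h))"
  proof -
    have "(norm (e - X *v h))\<^sup>2 = (norm e)\<^sup>2 - 2 * (e \<bullet> (X *v h)) + (norm (X *v h))\<^sup>2"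
      by (simp add: power2_norm_eq_inner inner_diff_left inner_diff_right inner_commute)
    then have "1 / n * ((norm e)\<^sup>2 - 2 * (e \<bullet> (X *v h))) \<le> 1 / n * (norm (e - X *v h))\<^sup>2"
      using n by (intro mult_left_mono) auto
    then show ?thesis by (simp add: right_diff_distrib)
  qed
  moreover have "2 / n * (e \<bullet> (X *v h)) \<le> r / \<alpha> * (a + b)"
    using noise by (simp add: n_def a_def b_def v_def[abs_def])
  ultimately have "0 \<le> r / \<alpha> * (a + b)
      + r * ((\<Sum>g\<in>UNIV. L2_set (($) \<beta>) (I g)) - (\<Sum>g\<in>UNIV. L2_set (($) \<beta>') (I g)))"
    unfolding right_diff_distrib by linarith
  also have "\<dots> = r * ((a + b) / \<alpha>
      + ((\<Sum>g\<in>UNIV. L2_set (($) \<beta>) (I g)) - (\<Sum>g\<in>UNIV. L2_set (($) \<beta>') (I g))))"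
    by (simp add: algebra_simps)
  finally have basic: "0 \<le> (a + b) / \<alpha>
      + ((\<Sum>g\<in>UNIV. L2_set (($) \<beta>) (I g)) - (\<Sum>g\<in>UNIV. L2_set (($) \<beta>') (I g)))"
    using r by (simp add: zero_le_mult_iff)
  \<comment> \<open>Triangle inequality for \<open>\<beta> = \<beta>' + (- h)\<close> within the
    group.\<close>
  have inA: "L2_set (($) \<beta>) (I g) \<le> L2_set (($) \<beta>') (I g) + v g" for g
    using L2_set_triangle_ineq[of "($) \<beta>'" "($) (- h)" "I g"]
    by (simp add: h v_def L2_set_def power2_commute[of "\<beta> $ _"])
  have outA: "L2_set (($) \<beta>) (I g) = 0" "L2_set (($) \<beta>') (I g) = v g" if "g \<in> - A" for g
  proof -
    have zero: "\<beta> $ j = 0" if "j \<in> I g" for j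
      using that \<open>g \<in> - A\<close> by (auto simp: A_def active_groups_eq[OF part] supp_def)
    then show "L2_set (($) \<beta>) (I g) = 0" by (intro L2_set_0') blast
    show "L2_set (($) \<beta>') (I g) = v g"
      unfolding v_def using zero by (intro L2_set_cong) (auto simp: h)
  qed
  have "(\<Sum>g\<in>UNIV. L2_set (($) \<beta>) (I g)) = (\<Sum>g\<in>A. L2_set (($) \<beta>) (I g))"
    using outA(1) by (simp add: sum_UNIV_split[of _ A])
  also have "\<dots> \<le> (\<Sum>g\<in>A. L2_set (($) \<beta>') (I g)) + sum v A"
    using sum_mono[of A, OF inA] by (simp add: sum.distrib)
  also have "\<dots> = (\<Sum>g\<in>UNIV. L2_set (($) \<beta>') (I g)) - sum v (- A) + sum v A"
    using outA(2) by (simp add: sum_UNIV_split[of _ A])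
  also have "\<dots> \<le> (\<Sum>g\<in>UNIV. L2_set (($) \<beta>') (I g)) - b + sum v J"
  \<comment> \<open>The active set \<open>A\<close> also has \<open>s\<close> elements, so passing
    from \<open>A\<close> to \<open>J\<close> can only increase the sum inside and decrease the sum
    outside.\<close>
  proof -
    have "sum v A \<le> sum v J"
      using J s by (intro highest_sum_ge) (auto simp: A_def v_def[abs_def])
    moreover have "sum v A + sum v (- A) = sum v J + b"
      unfolding b_def by (metis sum_UNIV_split)
    ultimately show ?thesis by linarith
  qed
  finally have "b \<le> (a + b) / \<alpha> + sum v J" using basic by linarith
  then have "(\<alpha> - 1) * b \<le> \<alpha> * sum v J + a"
    using \<alpha> by (simp add: field_simps)
  then have "b \<le> (\<alpha> * sum v J + a) / (\<alpha> - 1)"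
    using \<alpha> by (simp add: pos_le_divide_eq mult.commute)
  then have "b \<le> \<alpha> / (\<alpha> - 1) * sum v J + sqrt (real s) / (\<alpha> - 1) * L2_set v J"
    by (simp add: a_def add_divide_distrib)
  then show ?thesis
    unfolding group_cone_def
    by (simp add: L2_set_Union_groups[OF part] b_def v_def[abs_def])
qed

text \<open>Only the exceedances of the correlations \<open>u\<close> over \<open>\<kappa> + \<tau>\<close> are controlled jointly, in L2 norm;
  bounding each of them separately would lose the dependence of the regularization on \<open>s\<close>.\<close>

lemma group_lasso_cone_of_exceedance:
  fixes I :: "'g::finite \<Rightarrow> 'p::finite set" and X :: "real ^ 'p ^ 'n" and \<beta> \<beta>' h :: "real ^ 'p"
  assumes part: "group_partition I"
    and min: "minimizer (group_lasso_objective I X (X *v \<beta> + e) r) \<beta>'"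
    and \<alpha>: "1 < \<alpha>"
    and h: "h = \<beta>' - \<beta>"
    and s: "s = card (active_groups I \<beta>)" and "\<beta> \<noteq> 0"
    and J: "highest s (\<lambda>g. L2_set (($) h) (I g)) J"
    and u: "\<And>g. u g = L2_set (\<lambda>j. column j X \<bullet> e) (I g) / sqrt (real CARD('n))"
    and \<tau>: "0 < \<tau>" "(\<Sum>g\<in>UNIV. (max 0 (u g - \<kappa> g - \<tau>))\<^sup>2) \<le> real s * \<tau>\<^sup>2"
    and \<kappa>: "(\<Sum>g\<in>UNIV. \<kappa> g * L2_set (($) h) (I g)) \<le> C *
       (sqrt (real s) * L2_set (\<lambda>g. L2_set (($) h) (I g)) J + (\<Sum>g\<in>-J. L2_set (($) h) (I g)))"
    and C: "0 \<le> C"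
    and r: "r = 2 * \<alpha> * (3 * \<tau> + C) / sqrt (real CARD('n))"
  shows "h \<in> group_cone I J (\<alpha> / (\<alpha> - 1)) (sqrt (real s) / (\<alpha> - 1))"
proof -
  define n where "n = real CARD('n)"
  define v where "v g = L2_set (($) h) (I g)" for g
  define a where "a = sqrt (real s) * L2_set v J"
  define b where "b = (\<Sum>g\<in>-J. v g)"
  have n: "n > 0" by (simp add: n_def)
  have v: "0 \<le> v g" for g by (simp add: v_def)
  have J': "highest s v J" using J by (simp add: v_def[abs_def])
  have s0: "s > 0" unfolding s by (rule card_active_groups_pos) fact+
  have ab: "0 \<le> a" "0 \<le> b" using v by (auto simp: a_def b_def sum_nonneg)
  have "sum v UNIV \<le> a + b"
    using sum_le_sqrt_card_L2_set[of J v] v J'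
    by (simp add: sum_UNIV_split[of v J] a_def b_def highest_def)
  then have \<tau>v: "(\<Sum>g\<in>UNIV. \<tau> * v g) \<le> \<tau> * (a + b)"
    using \<tau>(1) by (simp flip: sum_distrib_left)
  have wv: "(\<Sum>g\<in>UNIV. max 0 (u g - \<kappa> g - \<tau>) * v g) \<le> \<tau> * (3 / 2 * a + b / 2)"
    using highest_sum_mult_le[OF v J' s0, of "\<lambda>g. max 0 (u g - \<kappa> g - \<tau>)" \<tau>] \<tau>
    by (simp add: a_def b_def)
  \<comment> \<open>Each \<open>u g\<close> is at most the level \<open>\<kappa> g + \<tau>\<close>
    plus its exceedance over that level.\<close>
  have "(\<Sum>g\<in>UNIV. u g * v g) \<le> (\<Sum>g\<in>UNIV. \<kappa> g * v g + \<tau> * v g + max 0 (u g - \<kappa> g - \<tau>) * v g)"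
    unfolding distrib_right[symmetric] using v by (intro sum_mono mult_right_mono) auto
  also have "\<dots> \<le> C * (a + b) + \<tau> * (a + b) + \<tau> * (3 / 2 * a + b / 2)"
    using \<kappa> \<tau>v wv by (simp add: sum.distrib a_def b_def v_def[abs_def])
  \<comment> \<open>The coefficients of \<open>\<tau> * a\<close> and \<open>\<tau> * b\<close> are
    5/2 and 3/2; both are rounded up to 3.\<close>
  also have "\<dots> \<le> (3 * \<tau> + C) * (a + b)"
  proof -
    have "0 \<le> \<tau> * a" "0 \<le> \<tau> * b" using ab \<tau>(1) by auto
    then show ?thesis by (simp add: algebra_simps)
  qed
  finally have uv: "(\<Sum>g\<in>UNIV. u g * v g) \<le> (3 * \<tau> + C) * (a + b)" .
  have "e \<bullet> (X *v h) \<le> (\<Sum>g\<in>UNIV. (sqrt n * u g) * v g)"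
    using inner_matrix_vector_mult_le_groups[OF part, of e X h] n by (simp add: u n_def v_def)
  also have "\<dots> = sqrt n * (\<Sum>g\<in>UNIV. u g * v g)"
    by (simp add: sum_distrib_left mult.assoc)
  also have "\<dots> \<le> sqrt n * ((3 * \<tau> + C) * (a + b))"
    using uv n by (intro mult_left_mono) auto
  finally have "2 / n * (e \<bullet> (X *v h)) \<le> 2 / n * (sqrt n * ((3 * \<tau> + C) * (a + b)))"
    using n by (intro mult_left_mono) auto
  also have "\<dots> = r / \<alpha> * (a + b)"
  proof -
    have "sqrt n / n = 1 / sqrt n" using n by (simp add: field_simps)
    then have "2 / n * (sqrt n * ((3 * \<tau> + C) * (a + b))) = 2 * (1 / sqrt n) * ((3 * \<tau> + C) * (a + b))"
      by (metis (no_types, lifting) mult.assoc times_divide_eq_left times_divide_eq_right)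
    then show ?thesis using \<alpha> by (simp add: r n_def)
  qed
  finally have noise: "2 / n * (e \<bullet> (X *v h)) \<le> r / \<alpha> * (a + b)" .
  have "0 < r" using \<tau>(1) C \<alpha> by (simp add: r)
  show ?thesis
    by (rule group_lasso_cone[OF part min \<open>0 < r\<close> \<alpha> h s J])
      (use noise in \<open>simp add: n_def a_def b_def v_def[abs_def]\<close>)
qed

section \<open>Probability bounds\<close>

lemma with_prob_at_least_mono:
  "with_prob_at_least M q P \<Longrightarrow> q' \<le> q \<Longrightarrow> (\<And>\<omega>. P \<omega> \<Longrightarrow> Q \<omega>) \<Longrightarrow> with_prob_at_least M q' Q"
  unfolding with_prob_at_least_def by (meson order_trans)

text \<open>\<open>C\<close> does not depend on the outcome, so it may be assumed before the event
  is chosen; if it fails, the whole space serves.\<close>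

lemma with_prob_at_least_imp:
  assumes "prob_space M" "q \<le> 1" "C \<Longrightarrow> with_prob_at_least M q P"
  shows "with_prob_at_least M q (\<lambda>\<omega>. C \<longrightarrow> P \<omega>)"
proof (cases C)
  case False
  then show ?thesis
    using assms(2) prob_space.prob_space[OF assms(1)]
    unfolding with_prob_at_least_def by (intro bexI[of _ "space M"]) auto
qed (use assms(3) in simp)

lemma with_prob_at_least_conj:
  assumes "prob_space M" "with_prob_at_least M (1 - a) P" "with_prob_at_least M (1 - b) Q"
  shows "with_prob_at_least M (1 - (a + b)) (\<lambda>\<omega>. P \<omega> \<and> Q \<omega>)"
proof -
  interpret prob_space M by fact
  obtain E F where E: "E \<in> sets M" "1 - a \<le> prob E" "\<And>\<omega>. \<omega> \<in> E \<Longrightarrow> P \<omega>"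
    and F: "F \<in> sets M" "1 - b \<le> prob F" "\<And>\<omega>. \<omega> \<in> F \<Longrightarrow> Q \<omega>"
    using assms(2,3) unfolding with_prob_at_least_def by blast
  have "prob (E \<union> F) = prob E + prob F - prob (E \<inter> F)"
    using finite_measure_Union'[OF E(1) F(1)] finite_measure_Diff'[OF F(1) E(1)]
    by (simp add: Int_commute)
  then have "1 - (a + b) \<le> prob (E \<inter> F)"
    using E(2) F(2) prob_le_1[of "E \<union> F"] by linarith
  then show ?thesis
    unfolding with_prob_at_least_def using E F by (intro bexI[of _ "E \<inter> F"]) auto
qed

section \<open>Exponential moments of the noise correlations\<close>

lemma borel_measurable_inner_noise:
  fixes \<epsilon> :: "'w \<Rightarrow> real ^ 'n"
  assumes "prob_space M" and "prob_space.indep_vars M (\<lambda>_. borel) (\<lambda>i \<omega>. \<epsilon> \<omega> $ i) UNIV"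
  shows "(\<lambda>\<omega>. c \<bullet> \<epsilon> \<omega>) \<in> borel_measurable M"
proof -
  interpret prob_space M by fact
  have [measurable]: "(\<lambda>\<omega>. \<epsilon> \<omega> $ i) \<in> borel_measurable M" for i
    using assms(2) unfolding indep_vars_def by auto
  show ?thesis unfolding inner_vec_def by simp
qed

text \<open>The exponential of \<open>t * \<bar>x\<bar>\<close> is at most the sum of those of
  \<open>t * x\<close> and \<open>- t * x\<close>, whence the factor 2.\<close>

lemma abs_correlation_mgf:
  fixes \<epsilon> :: "'w \<Rightarrow> real ^ 'n"
  assumes noise: "prob_space M" "prob_space.indep_vars M (\<lambda>_. borel) (\<lambda>i \<omega>. \<epsilon> \<omega> $ i) UNIV"
    "\<And>i. sub_gaussian M (\<lambda>\<omega>. \<epsilon> \<omega> $ i) \<sigma>"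
    and c: "norm c \<le> 1"
  shows "(\<integral>\<^sup>+\<omega>. ennreal (exp (t * \<bar>c \<bullet> \<epsilon> \<omega>\<bar>)) \<partial>M) \<le> ennreal (2 * exp (\<sigma>\<^sup>2 * t\<^sup>2 / 2))"
proof -
  note [measurable] = borel_measurable_inner_noise[OF noise(1,2)]
  have mgf: "(\<integral>\<^sup>+\<omega>. ennreal (exp ((r *\<^sub>R c) \<bullet> \<epsilon> \<omega>)) \<partial>M) \<le> ennreal (exp (\<sigma>\<^sup>2 * t\<^sup>2 / 2))"
    if "\<bar>r\<bar> = \<bar>t\<bar>" for r
  proof -
    have "(norm (r *\<^sub>R c))\<^sup>2 \<le> t\<^sup>2"
      using that mult_left_mono[OF c, of "\<bar>t\<bar>"] by (intro abs_le_square_iff[THEN iffD1]) simp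
    then have "exp (\<sigma>\<^sup>2 * (norm (r *\<^sub>R c))\<^sup>2 / 2) \<le> exp (\<sigma>\<^sup>2 * t\<^sup>2 / 2)"
      by (simp add: mult_left_mono divide_right_mono)
    then show ?thesis
      using sub_gaussian_inner_mgf[OF noise, of "r *\<^sub>R c"] by (meson ennreal_leI order_trans)
  qed
  have "(\<integral>\<^sup>+\<omega>. ennreal (exp (t * \<bar>c \<bullet> \<epsilon> \<omega>\<bar>)) \<partial>M)
      \<le> (\<integral>\<^sup>+\<omega>. ennreal (exp ((t *\<^sub>R c) \<bullet> \<epsilon> \<omega>)) + ennreal (exp (((- t) *\<^sub>R c) \<bullet> \<epsilon> \<omega>)) \<partial>M)"
    by (intro nn_integral_mono) (auto simp: abs_if simp flip: ennreal_plus intro!: ennreal_leI)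
  also have "\<dots> = (\<integral>\<^sup>+\<omega>. ennreal (exp ((t *\<^sub>R c) \<bullet> \<epsilon> \<omega>)) \<partial>M)
      + (\<integral>\<^sup>+\<omega>. ennreal (exp (((- t) *\<^sub>R c) \<bullet> \<epsilon> \<omega>)) \<partial>M)"
    by (rule nn_integral_add) measurable
  also have "\<dots> \<le> ennreal (exp (\<sigma>\<^sup>2 * t\<^sup>2 / 2)) + ennreal (exp (\<sigma>\<^sup>2 * t\<^sup>2 / 2))"
    by (intro add_mono mgf) auto
  also have "\<dots> = ennreal (2 * exp (\<sigma>\<^sup>2 * t\<^sup>2 / 2))"
    by (simp flip: ennreal_plus)
  finally show ?thesis .
qed

text \<open>The eigenvalue bound makes \<open>X / sqrt n\<close> a contraction on vectors supported
  on \<open>S\<close>. Every linear combination of the normalized correlations is therefore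
  sub-Gaussian with proxy \<open>\<sigma>\<close> times the norm of its coefficients, as
  \<open>sub_gaussian_norm_mgf\<close> requires.\<close>

lemma group_correlation_mgf:
  fixes \<epsilon> :: "'w \<Rightarrow> real ^ 'n" and X :: "real ^ 'p ^ 'n"
  assumes noise: "prob_space M" "prob_space.indep_vars M (\<lambda>_. borel) (\<lambda>i \<omega>. \<epsilon> \<omega> $ i) UNIV"
    "\<And>i. sub_gaussian M (\<lambda>\<omega>. \<epsilon> \<omega> $ i) \<sigma>"
    and "0 < \<sigma>" "0 < t" and S: "S \<noteq> {}" "mu_max S (gram X) \<le> real CARD('n)"
  shows "(\<integral>\<^sup>+\<omega>. ennreal (exp (t * (L2_set (\<lambda>j. column j X \<bullet> \<epsilon> \<omega>) S / sqrt (real CARD('n))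
             - \<sigma> * sqrt (card S)))) \<partial>M)
           \<le> ennreal (exp (\<sigma>\<^sup>2 * t\<^sup>2 / 2))"
proof -
  define n where "n = real CARD('n)"
  have n: "n > 0" by (simp add: n_def)
  define W where "W j \<omega> = column j X \<bullet> \<epsilon> \<omega> / sqrt n" for j \<omega>
  have vec: "(\<integral>\<^sup>+\<omega>. ennreal (exp (\<Sum>j\<in>S. z j * W j \<omega>)) \<partial>M)
      \<le> ennreal (exp (\<sigma>\<^sup>2 * (\<Sum>j\<in>S. (z j)\<^sup>2) / 2))" for z
  proof -
    define w :: "real ^ 'p" where "w = (\<chi> j. if j \<in> S then z j else 0)"
    define c where "c = (1 / sqrt n) *\<^sub>R (X *v w)"
    have "(norm c)\<^sup>2 = (norm (X *v w))\<^sup>2 / n"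
      using n by (simp add: c_def power_divide)
    also have "\<dots> \<le> n * (norm w)\<^sup>2 / n"
      using norm_matrix_vector_mult_le_mu_max[of S w X] mult_right_mono[OF S(2), of "(norm w)\<^sup>2"] n
      by (intro divide_right_mono) (auto simp: w_def n_def)
    also have "\<dots> = (\<Sum>j\<in>UNIV. (w $ j)\<^sup>2)"
      using n by (simp add: norm_vec_def L2_set_def sum_nonneg)
    also have "\<dots> = (\<Sum>j\<in>S. (z j)\<^sup>2)"
      by (rule sum.mono_neutral_cong_right) (auto simp: w_def)
    finally have c: "(norm c)\<^sup>2 \<le> (\<Sum>j\<in>S. (z j)\<^sup>2)" .
    have "X *v w = (\<Sum>j\<in>S. w $ j *\<^sub>R column j X)"
      by (rule matrix_vector_mult_supported) (simp add: w_def)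
    then have "(\<Sum>j\<in>S. z j * W j \<omega>) = c \<bullet> \<epsilon> \<omega>" for \<omega>
      by (simp add: c_def W_def w_def inner_sum_left sum_divide_distrib)
    then have "(\<integral>\<^sup>+\<omega>. ennreal (exp (\<Sum>j\<in>S. z j * W j \<omega>)) \<partial>M)
        \<le> ennreal (exp (\<sigma>\<^sup>2 * (norm c)\<^sup>2 / 2))"
      using sub_gaussian_inner_mgf[OF noise, of c] by simp
    also have "\<dots> \<le> ennreal (exp (\<sigma>\<^sup>2 * (\<Sum>j\<in>S. (z j)\<^sup>2) / 2))"
      using c by (intro ennreal_leI) (simp add: mult_left_mono divide_right_mono)
    finally show ?thesis .
  qed
  have "(\<integral>\<^sup>+\<omega>. ennreal (exp (t * (L2_set (\<lambda>j. W j \<omega>) S - \<sigma> * sqrt (card S)))) \<partial>M)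
      \<le> ennreal (exp (\<sigma>\<^sup>2 * t\<^sup>2 / 2))"
    using borel_measurable_inner_noise[OF noise(1,2)] S(1) \<open>0 < \<sigma>\<close> \<open>0 < t\<close> vec noise(1)
    by (intro sub_gaussian_norm_mgf) (auto simp: W_def)
  moreover have "L2_set (\<lambda>j. W j \<omega>) S = L2_set (\<lambda>j. column j X \<bullet> \<epsilon> \<omega>) S / sqrt n" for \<omega>
    using L2_set_left_distrib[of "1 / sqrt n" "\<lambda>j. column j X \<bullet> \<epsilon> \<omega>" S] n by (simp add: W_def)
  ultimately show ?thesis by (simp add: n_def)
qed

section \<open>The Lasso as the case of singleton groups\<close>

lemma group_partition_singletons: "group_partition (\<lambda>j. {j})"
  by (auto simp: group_partition_def disjoint_family_on_def)

lemma lasso_objective_eq_group: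
  fixes X :: "real ^ 'p ^ 'n"
  shows "lasso_objective X y r = group_lasso_objective (\<lambda>j. {j}) X y r"
  by (simp add: fun_eq_iff lasso_objective_def group_lasso_objective_def)

lemma l1_cone_eq_group: "l1_cone S a b = group_cone (\<lambda>j. {j}) S a b" for S :: "'p::finite set"
  by (simp add: l1_cone_def group_cone_def)

text \<open>For a single column the two-sided moment bound replaces the subtraction of a mean level,
  so both \<open>\<kappa>\<close> and \<open>C\<close> are zero.\<close>

lemma lasso_cone_with_prob:
  fixes X :: "real ^ 'p ^ 'n" and \<beta> :: "real ^ 'p" and \<epsilon> :: "'w \<Rightarrow> real ^ 'n"
  assumes noise: "prob_space M" "prob_space.indep_vars M (\<lambda>_. borel) (\<lambda>i \<omega>. \<epsilon> \<omega> $ i) UNIV"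
    "\<And>i. sub_gaussian M (\<lambda>\<omega>. \<epsilon> \<omega> $ i) \<sigma>"
    and "0 < \<sigma>" "\<beta> \<noteq> 0" "0 < \<delta>" "\<delta> \<le> 1 / 2" "1 < \<alpha>"
    and k: "k = card (supp \<beta>)"
    and X: "\<And>j. norm (column j X) \<le> sqrt (real CARD('n))"
  shows "with_prob_at_least M (1 - \<delta> / 2) (\<lambda>\<omega>. \<forall>\<beta>1 h S.
      minimizer (lasso_objective X (X *v \<beta> + \<epsilon> \<omega>) (lasso_lambda \<alpha> \<sigma> \<delta> CARD('n) CARD('p) k)) \<beta>1
      \<and> h = \<beta>1 - \<beta> \<and> highest k (\<lambda>j. \<bar>h $ j\<bar>) S
      \<longrightarrow> h \<in> l1_cone S (\<alpha> / (\<alpha> - 1)) (sqrt (real k) / (\<alpha> - 1)))"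
proof -
  define n where "n = real CARD('n)"
  have n: "n > 0" by (simp add: n_def)
  let ?I = "\<lambda>j::'p. {j}"
  have active: "active_groups ?I \<beta> = supp \<beta>"
    by (auto simp: active_groups_eq[OF group_partition_singletons])
  have k0: "0 < k" "k \<le> CARD('p)"
    using card_active_groups_pos[OF group_partition_singletons \<open>\<beta> \<noteq> 0\<close>] card_mono[of UNIV "supp \<beta>"]
    by (auto simp: active k)
  define D where "D = ln (1 / \<delta>)"
  define \<tau> where "\<tau> = 4 * \<sigma> * sqrt (ln (2 * real CARD('p) * exp 1 / real k) * D)"
  have expD: "exp (- D) = \<delta>" using \<open>0 < \<delta>\<close> by (simp add: D_def ln_div)
  \<comment> \<open>Here \<open>\<delta> \<le> 1 / 2\<close> gives \<open>D \<ge> ln 2\<close>. It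
    follows from \<open>\<delta> < 1 / n\<close> when \<open>n \<ge> 2\<close>, but not when
    \<open>n = 1\<close>.\<close>
  have D: "1 / 2 \<le> D"
  proof -
    have "1 / 2 \<le> ln (2::real)" using ln2_ge_two_thirds by simp
    also have "\<dots> \<le> D" unfolding D_def using assms by (subst ln_le_cancel_iff) (auto simp: field_simps)
    finally show ?thesis .
  qed
  have "exp 1 \<le> 2 * real CARD('p) * exp 1 / real k"
    using k0 by (simp add: field_simps)
  then have "0 < ln (2 * real CARD('p) * exp 1 / real k)"
    using one_less_exp_iff[of 1] by (intro ln_gt_zero) linarith
  then have \<tau>0: "0 < \<tau>" using D \<open>0 < \<sigma>\<close> by (simp add: \<tau>_def)
  \<comment> \<open>The constant 24 is 2 times 3 times the 4 in \<open>\<tau>\<close>; the summand 0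
    stands for \<open>C\<close>.\<close>
  have lam: "lasso_lambda \<alpha> \<sigma> \<delta> CARD('n) CARD('p) k = 2 * \<alpha> * (3 * \<tau> + 0) / sqrt (real CARD('n))"
    by (simp add: lasso_lambda_def \<tau>_def D_def real_sqrt_mult real_sqrt_divide)
  define R where "R j \<omega> = \<bar>(1 / sqrt n) *\<^sub>R column j X \<bullet> \<epsilon> \<omega>\<bar>" for j \<omega>
  have "with_prob_at_least M (1 - exp (- D) / 2)
      (\<lambda>\<omega>. (\<Sum>j\<in>UNIV. (max 0 (R j \<omega> - \<tau>))\<^sup>2) \<le> real k * \<tau>\<^sup>2)"
  proof (rule sum_sq_exceedance_bound[OF noise(1) _ \<open>0 < \<sigma>\<close> _ k0 D])
    show "R j \<in> borel_measurable M" for j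
      unfolding R_def using borel_measurable_inner_noise[OF noise(1,2)] by (intro borel_measurable_abs)
    show "(\<integral>\<^sup>+\<omega>. ennreal (exp (t * R j \<omega>)) \<partial>M) \<le> ennreal (2 * exp (\<sigma>\<^sup>2 * t\<^sup>2 / 2))" for j t
      unfolding R_def using X[of j] n by (intro abs_correlation_mgf[OF noise]) (simp add: n_def)
  qed (simp add: \<tau>_def)
  then show ?thesis
  proof (rule with_prob_at_least_mono)
    fix \<omega>
    assume ev: "(\<Sum>j\<in>UNIV. (max 0 (R j \<omega> - \<tau>))\<^sup>2) \<le> real k * \<tau>\<^sup>2"
    show "\<forall>\<beta>1 h S. minimizer (lasso_objective X (X *v \<beta> + \<epsilon> \<omega>)
          (lasso_lambda \<alpha> \<sigma> \<delta> CARD('n) CARD('p) k)) \<beta>1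
        \<and> h = \<beta>1 - \<beta> \<and> highest k (\<lambda>j. \<bar>h $ j\<bar>) S
        \<longrightarrow> h \<in> l1_cone S (\<alpha> / (\<alpha> - 1)) (sqrt (real k) / (\<alpha> - 1))"
    proof (intro allI impI, elim conjE)
      fix \<beta>1 h S
      assume min: "minimizer (lasso_objective X (X *v \<beta> + \<epsilon> \<omega>)
          (lasso_lambda \<alpha> \<sigma> \<delta> CARD('n) CARD('p) k)) \<beta>1"
        and h: "h = \<beta>1 - \<beta>" and S: "highest k (\<lambda>j. \<bar>h $ j\<bar>) S"
      show "h \<in> l1_cone S (\<alpha> / (\<alpha> - 1)) (sqrt (real k) / (\<alpha> - 1))"
        unfolding l1_cone_eq_group
      proof (rule group_lasso_cone_of_exceedance[OF group_partition_singletons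
            min[unfolded lasso_objective_eq_group] \<open>1 < \<alpha>\<close> h _ \<open>\<beta> \<noteq> 0\<close> _ _ \<tau>0 _ _ _ lam])
        show "k = card (active_groups ?I \<beta>)" by (simp add: active k)
        show "highest k (\<lambda>j. L2_set (($) h) {j}) S" using S by simp
        show "R j \<omega> = L2_set (\<lambda>j. column j X \<bullet> \<epsilon> \<omega>) {j} / sqrt (real CARD('n))" for j
          using n by (simp add: R_def n_def abs_mult)
        show "(\<Sum>j\<in>UNIV. (max 0 (R j \<omega> - 0 - \<tau>))\<^sup>2) \<le> real k * \<tau>\<^sup>2" using ev by simp
      qed auto
    qed
  qed (simp add: expD)
qed

text \<open>The mean levels \<open>\<kappa> g\<close> depend on the group size, and their total
  effect is bounded through the \<open>s\<close> largest groups; this produces the second summand of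
  the regularization.\<close>

lemma group_lasso_cone_with_prob:
  fixes X :: "real ^ 'p ^ 'n" and \<beta> :: "real ^ 'p" and \<epsilon> :: "'w \<Rightarrow> real ^ 'n"
    and I :: "'g::finite \<Rightarrow> 'p set"
  assumes noise: "prob_space M" "prob_space.indep_vars M (\<lambda>_. borel) (\<lambda>i \<omega>. \<epsilon> \<omega> $ i) UNIV"
    "\<And>i. sub_gaussian M (\<lambda>\<omega>. \<epsilon> \<omega> $ i) \<sigma>"
    and "0 < \<sigma>" "\<beta> \<noteq> 0" "0 < \<delta>" "\<delta> \<le> 1" "1 < \<alpha>"
    and part: "group_partition I"
    and s: "s = card (active_groups I \<beta>)"
    and X: "\<And>g. mu_max (I g) (gram X) \<le> real CARD('n)"
    and L: "highest s (\<lambda>g. real (card (I g))) L" "real (total_size I L) \<le> \<gamma> * real m"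
  shows "with_prob_at_least M (1 - \<delta> / 2) (\<lambda>\<omega>. \<forall>\<beta>2 h J.
      minimizer (group_lasso_objective I X (X *v \<beta> + \<epsilon> \<omega>)
        (group_lasso_lambda \<alpha> \<sigma> \<delta> \<gamma> CARD('n) CARD('g) s m)) \<beta>2
      \<and> h = \<beta>2 - \<beta> \<and> highest s (\<lambda>g. L2_set (($) h) (I g)) J
      \<longrightarrow> h \<in> group_cone I J (\<alpha> / (\<alpha> - 1)) (sqrt (real s) / (\<alpha> - 1)))"
proof -
  define n where "n = real CARD('n)"
  have n: "n > 0" by (simp add: n_def)
  have s0: "0 < s" "s \<le> CARD('g)"
    using card_active_groups_pos[OF part \<open>\<beta> \<noteq> 0\<close>] card_mono[of UNIV "active_groups I \<beta>"]
    by (auto simp: s)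
  define D where "D = ln (2 / \<delta>)"
  define \<tau> where "\<tau> = 4 * \<sigma> * sqrt (ln (2 * real CARD('g) * exp 1 / real s) * D)"
  define C where "C = 2 * \<sigma> * sqrt (\<gamma> * real m / real s)"
  \<comment> \<open>The exceedance event thus fails with probability at most
    \<open>\<delta> / 4\<close>, weakened to \<open>\<delta> / 2\<close> at the end.\<close>
  have expD: "exp (- D) = \<delta> / 2" using \<open>0 < \<delta>\<close> by (simp add: D_def ln_div exp_diff)
  have D: "1 / 2 \<le> D"
  proof -
    have "1 / 2 \<le> ln (2::real)" using ln2_ge_two_thirds by simp
    also have "\<dots> \<le> D" unfolding D_def using assms by (subst ln_le_cancel_iff) (auto simp: field_simps)
    finally show ?thesis .
  qed
  have "exp 1 \<le> 2 * real CARD('g) * exp 1 / real s"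
    using s0 by (simp add: field_simps)
  then have "0 < ln (2 * real CARD('g) * exp 1 / real s)"
    using one_less_exp_iff[of 1] by (intro ln_gt_zero) linarith
  then have \<tau>0: "0 < \<tau>" using D \<open>0 < \<sigma>\<close> by (simp add: \<tau>_def)
  have \<gamma>m: "0 \<le> \<gamma> * real m" using L(2) by (meson of_nat_0_le_iff order_trans)
  then have C0: "0 \<le> C" using \<open>0 < \<sigma>\<close> by (simp add: C_def)
  \<comment> \<open>The 24 arises as for the Lasso; the 4 in the second summand is 2 times the 2 in
    \<open>C\<close>.\<close>
  have lam: "group_lasso_lambda \<alpha> \<sigma> \<delta> \<gamma> CARD('n) CARD('g) s m
      = 2 * \<alpha> * (3 * \<tau> + C) / sqrt (real CARD('n))"
    by (simp add: group_lasso_lambda_def \<tau>_def C_def D_def real_sqrt_mult real_sqrt_divide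
        add_divide_distrib distrib_left mult_ac)
  define u where "u g \<omega> = L2_set (\<lambda>j. column j X \<bullet> \<epsilon> \<omega>) (I g) / sqrt (real CARD('n))" for g \<omega>
  define \<kappa> where "\<kappa> g = \<sigma> * sqrt (real (card (I g)))" for g
  have "with_prob_at_least M (1 - exp (- D) / 2)
      (\<lambda>\<omega>. (\<Sum>g\<in>UNIV. (max 0 ((u g \<omega> - \<kappa> g) - \<tau>))\<^sup>2) \<le> real s * \<tau>\<^sup>2)"
  proof (rule sum_sq_exceedance_bound[OF noise(1) _ \<open>0 < \<sigma>\<close> _ s0 D])
    show "(\<lambda>\<omega>. u g \<omega> - \<kappa> g) \<in> borel_measurable M" for g
    proof -
      note [measurable] = borel_measurable_inner_noise[OF noise(1,2)]
      show ?thesis unfolding u_def L2_set_def by simp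
    qed
    show "(\<integral>\<^sup>+\<omega>. ennreal (exp (t * (u g \<omega> - \<kappa> g))) \<partial>M) \<le> ennreal (2 * exp (\<sigma>\<^sup>2 * t\<^sup>2 / 2))"
      if "0 < t" for g t
    proof -
      have "I g \<noteq> {}" using part by (simp add: group_partition_def)
      from group_correlation_mgf[OF noise \<open>0 < \<sigma>\<close> that this X]
      have "(\<integral>\<^sup>+\<omega>. ennreal (exp (t * (u g \<omega> - \<kappa> g))) \<partial>M) \<le> ennreal (exp (\<sigma>\<^sup>2 * t\<^sup>2 / 2))"
        by (simp add: u_def \<kappa>_def)
      also have "\<dots> \<le> ennreal (2 * exp (\<sigma>\<^sup>2 * t\<^sup>2 / 2))" by (intro ennreal_leI) simp
      finally show ?thesis .
    qed
  qed (simp add: \<tau>_def)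
  then show ?thesis
  proof (rule with_prob_at_least_mono)
    fix \<omega>
    assume ev: "(\<Sum>g\<in>UNIV. (max 0 ((u g \<omega> - \<kappa> g) - \<tau>))\<^sup>2) \<le> real s * \<tau>\<^sup>2"
    show "\<forall>\<beta>2 h J. minimizer (group_lasso_objective I X (X *v \<beta> + \<epsilon> \<omega>)
          (group_lasso_lambda \<alpha> \<sigma> \<delta> \<gamma> CARD('n) CARD('g) s m)) \<beta>2
        \<and> h = \<beta>2 - \<beta> \<and> highest s (\<lambda>g. L2_set (($) h) (I g)) J
        \<longrightarrow> h \<in> group_cone I J (\<alpha> / (\<alpha> - 1)) (sqrt (real s) / (\<alpha> - 1))"
    proof (intro allI impI, elim conjE)
      fix \<beta>2 h J
      assume min: "minimizer (group_lasso_objective I X (X *v \<beta> + \<epsilon> \<omega>)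
          (group_lasso_lambda \<alpha> \<sigma> \<delta> \<gamma> CARD('n) CARD('g) s m)) \<beta>2"
        and h: "h = \<beta>2 - \<beta>" and J: "highest s (\<lambda>g. L2_set (($) h) (I g)) J"
      define v where "v g = L2_set (($) h) (I g)" for g
      have v: "0 \<le> v g" for g by (simp add: v_def)
      show "h \<in> group_cone I J (\<alpha> / (\<alpha> - 1)) (sqrt (real s) / (\<alpha> - 1))"
      proof (rule group_lasso_cone_of_exceedance[OF part min \<open>1 < \<alpha>\<close> h s \<open>\<beta> \<noteq> 0\<close> J u_def \<tau>0 ev _ C0 lam])
        have "(\<Sum>g\<in>UNIV. sqrt (real (card (I g))) * v g)
            \<le> sqrt (\<gamma> * real m / real s) * (2 * (sqrt (real s) * L2_set v J) + (\<Sum>g\<in>-J. v g))"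
          using J L s0 v by (intro highest_sum_sqrt_mult_le) (auto simp: v_def[abs_def] total_size_def)
        \<comment> \<open>The coefficient of the outer sum is raised from 1 to 2, so that both terms
          share the constant \<open>C\<close>.\<close>
        also have "\<dots> \<le> sqrt (\<gamma> * real m / real s) * (2 * (sqrt (real s) * L2_set v J + (\<Sum>g\<in>-J. v g)))"
          using \<gamma>m v by (intro mult_left_mono) (auto simp: sum_nonneg)
        finally have "\<sigma> * (\<Sum>g\<in>UNIV. sqrt (real (card (I g))) * v g)
            \<le> \<sigma> * (sqrt (\<gamma> * real m / real s) * (2 * (sqrt (real s) * L2_set v J + (\<Sum>g\<in>-J. v g))))"
          using \<open>0 < \<sigma>\<close> by (intro mult_left_mono) auto
        then show "(\<Sum>g\<in>UNIV. \<kappa> g * L2_set (($) h) (I g)) \<le> C *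
            (sqrt (real s) * L2_set (\<lambda>g. L2_set (($) h) (I g)) J + (\<Sum>g\<in>-J. L2_set (($) h) (I g)))"
          by (simp add: \<kappa>_def C_def v_def[abs_def] sum_distrib_left mult.assoc mult.left_commute[of 2])
      qed
    qed
  qed (use \<open>0 < \<delta>\<close> in \<open>simp add: expD\<close>)
qed

theorem theorem1:
  fixes M :: "'w measure"
    and X :: "real ^ 'p ^ 'n"
    and \<beta>star :: "real ^ 'p"
    and \<epsilon> y :: "'w \<Rightarrow> real ^ 'n"
    and I :: "'g::finite \<Rightarrow> 'p set"
    and \<sigma> \<alpha> \<delta> \<gamma> :: real
    and kstar sstar mstar :: nat
  assumes "prob_space M"
    and "prob_space.indep_vars M (\<lambda>_. borel) (\<lambda>i \<omega>. \<epsilon> \<omega> $ i) UNIV"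
    and "\<And>i. sub_gaussian M (\<lambda>\<omega>. \<epsilon> \<omega> $ i) \<sigma>"
    and "\<sigma> > 0"
    and "\<And>\<omega>. y \<omega> = X *v \<beta>star + \<epsilon> \<omega>"
    and "\<beta>star \<noteq> 0"
    and "kstar = card (supp \<beta>star)"
    and "group_partition I"
    and "sstar = card (active_groups I \<beta>star)"
    and "mstar = total_size I (active_groups I \<beta>star)"
    and "0 < \<delta>" and "\<delta> < 1 / real CARD('n)"
    and "\<alpha> \<ge> 2"
  shows "with_prob_at_least M (1 - \<delta>) (\<lambda>\<omega>.
     (\<delta> \<le> 1 / 2 \<and> (\<forall>j. norm (column j X) \<le> sqrt (real CARD('n)))
       \<longrightarrow> (\<forall>\<beta>1 h1 S0.
             minimizer (lasso_objective X (y \<omega>) (lasso_lambda \<alpha> \<sigma> \<delta> CARD('n) CARD('p) kstar)) \<beta>1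
             \<and> h1 = \<beta>1 - \<beta>star
             \<and> highest kstar (\<lambda>j. \<bar>h1 $ j\<bar>) S0
             \<longrightarrow> h1 \<in> l1_cone S0 (\<alpha> / (\<alpha> - 1)) (sqrt (real kstar) / (\<alpha> - 1))))
   \<and> ((SUP g. mu_max (I g) (gram X)) \<le> real CARD('n)
       \<and> (\<exists>L. highest sstar (\<lambda>g. real (card (I g))) L \<and> real (total_size I L) \<le> \<gamma> * real mstar)
       \<and> \<gamma> \<ge> 1
       \<longrightarrow> (\<forall>\<beta>2 h2 J0.
             minimizer (group_lasso_objective I X (y \<omega>)
               (group_lasso_lambda \<alpha> \<sigma> \<delta> \<gamma> CARD('n) CARD('g) sstar mstar)) \<beta>2
             \<and> h2 = \<beta>2 - \<beta>star
             \<and> highest sstar (\<lambda>g. L2_set (($) h2) (I g)) J0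
             \<longrightarrow> h2 \<in> group_cone I J0 (\<alpha> / (\<alpha> - 1)) (sqrt (real sstar) / (\<alpha> - 1)))))"
proof -
  have \<delta>: "\<delta> \<le> 1"
  proof -
    have "1 / real CARD('n) \<le> 1" by (simp add: Suc_leI)
    with assms(12) show ?thesis by linarith
  qed
  have y: "y = (\<lambda>\<omega>. X *v \<beta>star + \<epsilon> \<omega>)" using assms(5) by blast
  have "1 < \<alpha>" using assms(13) by simp
  \<comment> \<open>There are finitely many groups, so the supremum is over a bounded family and
    dominates each member.\<close>
  have mu: "mu_max (I g) (gram X) \<le> real CARD('n)"
    if "(SUP g. mu_max (I g) (gram X)) \<le> real CARD('n)" for g
    using that cSUP_upper[of g UNIV "\<lambda>g. mu_max (I g) (gram X)"] by simp
  have "with_prob_at_least M (1 - (\<delta> / 2 + \<delta> / 2)) (\<lambda>\<omega>.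
     (\<delta> \<le> 1 / 2 \<and> (\<forall>j. norm (column j X) \<le> sqrt (real CARD('n)))
       \<longrightarrow> (\<forall>\<beta>1 h1 S0.
             minimizer (lasso_objective X (y \<omega>) (lasso_lambda \<alpha> \<sigma> \<delta> CARD('n) CARD('p) kstar)) \<beta>1
             \<and> h1 = \<beta>1 - \<beta>star
             \<and> highest kstar (\<lambda>j. \<bar>h1 $ j\<bar>) S0
             \<longrightarrow> h1 \<in> l1_cone S0 (\<alpha> / (\<alpha> - 1)) (sqrt (real kstar) / (\<alpha> - 1))))
   \<and> ((SUP g. mu_max (I g) (gram X)) \<le> real CARD('n)
       \<and> (\<exists>L. highest sstar (\<lambda>g. real (card (I g))) L \<and> real (total_size I L) \<le> \<gamma> * real mstar)
       \<and> \<gamma> \<ge> 1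
       \<longrightarrow> (\<forall>\<beta>2 h2 J0.
             minimizer (group_lasso_objective I X (y \<omega>)
               (group_lasso_lambda \<alpha> \<sigma> \<delta> \<gamma> CARD('n) CARD('g) sstar mstar)) \<beta>2
             \<and> h2 = \<beta>2 - \<beta>star
             \<and> highest sstar (\<lambda>g. L2_set (($) h2) (I g)) J0
             \<longrightarrow> h2 \<in> group_cone I J0 (\<alpha> / (\<alpha> - 1)) (sqrt (real sstar) / (\<alpha> - 1)))))"
    unfolding y
  \<comment> \<open>Each part may fail with probability \<open>\<delta> / 2\<close>. Cases 4 and 7
    are the Lasso and the group Lasso, each under its own deterministic hypotheses; the others are
    \<open>prob_space M\<close> and \<open>1 - \<delta> / 2 \<le> 1\<close>.\<close>
  proof (intro with_prob_at_least_conj with_prob_at_least_imp, goal_cases)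
    case 4
    then show ?case
      by (intro lasso_cone_with_prob[OF assms(1-4,6,11) _ \<open>1 < \<alpha>\<close> assms(7)]) auto
  next
    case 7
    then obtain L where "highest sstar (\<lambda>g. real (card (I g))) L"
      "real (total_size I L) \<le> \<gamma> * real mstar" by blast
    with 7 show ?case
      by (intro group_lasso_cone_with_prob[OF assms(1-4,6,11) \<delta> \<open>1 < \<alpha>\<close> assms(8,9)] mu) auto
  qed (use assms(1,11) in auto)
  then show ?thesis by simp
qed

end
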